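(* Let $T>0$, let $X$ solve the $d$-dimensional Itô SDE $$X(t)=X_0+\int_{0}^{t}\mu(X(s))\,ds+\sum_{j=1}^m\int_{0}^{t}\sigma_j(X(s))\,dW_j(s),\qquad 0\le t\le T,$$ driven by an $m$-dimensional standard Wiener process $W=(W_1,\dots,W_m)$, with deterministic $X_0\in\mathbb{R}^d$. Fix a finest level $L\ge 1$ and use the weak (binomial) increments, the coupled weak Milstein scheme without Lévy areas, and the antithetic fine/coarse payoffs described in the context. Let $f:\mathbb{R}^d\to\mathbb{R}$ be Lipschitz continuous and in $C^2(\mathbb{R}^d,\mathbb{R})$. Then there is a constant $C$, independent of $l$ and of $L$, such that for all $1\le l\le L$ $$\operatorname{Var}\big(\hat P^f_l-\hat P^c_{l-1}\big)\le \mathbb{E}\big[(\hat P^f_l-\hat P^c_{l-1})^2\big]\le C\,\Delta_l^{2},$$ i.e. the multilevel correction variance decays with order $\beta=2$.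
   Context: Standing assumptions: $\mu:\mathbb{R}^d\to\mathbb{R}^d$ and each $\sigma_j:\mathbb{R}^d\to\mathbb{R}^d$ ($j=1,\dots,m$) are in $C^2$ (as in the setting of Giles–Szpruch's antithetic MLMC, they are taken globally Lipschitz with bounded first and second derivatives); $f$ is Lipschitz and $C^2$ (with bounded second derivatives). $\sigma_j'$ denotes the Jacobian matrix of $\sigma_j$. Step sizes: $\Delta_l=2^{-l}T$, $l=0,\dots,L$; level $l$ uses $N_l=2^l$ steps. Weak increments: let $\xi^f_{L,i,j}$, $i=1,\dots,2^L$, $j=1,\dots,m$, be i.i.d. with $\mathbb{P}(\xi^f_{L,i,j}=\sqrt{\Delta_L})=\mathbb{P}(\xi^f_{L,i,j}=-\sqrt{\Delta_L})=\tfrac12$. For $l<L$ define the fine increments at level $l$ by summing consecutive finest increments: $\xi^f_{l,i}=\sum_{r=(i-1)2^{L-l}+1}^{i\,2^{L-l}}\xi^f_{L,r}\in\mathbb{R}^m$, $i=1,\dots,2^l$; equivalently each component is distributed as $(\mathrm{Bin}(2^{L-l},\tfrac12)-2^{L-l-1})\cdot 2\sqrt{\Delta_L}$. Coarse increments for the level-$l$ correction are coupled by $\xi^c_{l-1,i}=\xi^f_{l,2i-1}+\xi^f_{l,2i}$, $i=1,\dots,2^{l-1}$ (so $\xi^c_{l-1,i}$ has the same law as $\xi^f_{l-1,i}$). Antithetic increments: $\xi^a_{l,2i-1}=\xi^f_{l,2i}$, $\xi^a_{l,2i}=\xi^f_{l,2i-1}$ for all $i$. Weak Milstein scheme without Lévy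 areas at level $k$ with increments $\xi_{k,\cdot}$ (here $\xi_{k,i,j}$ is the $j$-th component): $X_{k,0}=X_0$ and for $i=1,\dots,2^k$ $$X_{k,i}=X_{k,i-1}+\mu(X_{k,i-1})\Delta_k+\sum_{j=1}^m\sigma_j(X_{k,i-1})\,\xi_{k,i,j}+\frac12\sum_{j,k'=1}^m\sigma_j'(X_{k,i-1})\sigma_{k'}(X_{k,i-1})\big(\xi_{k,i,j}\xi_{k,i,k'}-\delta_{jk'}\Delta_k\big).$$ $X^f_{l,\cdot}$, $X^a_{l,\cdot}$ are this scheme at level $l$ with increments $\xi^f_{l,\cdot}$, $\xi^a_{l,\cdot}$ respectively, and $X^c_{l-1,\cdot}$ is the scheme at level $l-1$ with increments $\xi^c_{l-1,\cdot}$ (all built from the same underlying finest increments). Antithetic payoffs: $\hat P^f_l=\tfrac12\big(f(X^f_{l,2^l})+f(X^a_{l,2^l})\big)$ and $\hat P^c_{l-1}=f(X^c_{l-1,2^{l-1}})$. *)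

theory Defs
  imports "HOL-Probability.Probability"
begin

definition C2_bounded :: "('a::euclidean_space \<Rightarrow> 'b::euclidean_space) \<Rightarrow> bool" where
  "C2_bounded g \<longleftrightarrow>
     (\<exists>D D2 K.
        (\<forall>x. (g has_derivative blinfun_apply (D x)) (at x)) \<and>
        (\<forall>x. (D has_derivative blinfun_apply (D2 x)) (at x)) \<and>
        continuous_on UNIV D2 \<and>
        (\<forall>x. norm (D x) \<le> K \<and> norm (D2 x) \<le> K)) \<and>
     (\<exists>K. lipschitz_on K UNIV g)"

definition step_size :: "real \<Rightarrow> nat \<Rightarrow> real" where
  "step_size T k = T / 2 ^ k"

text \<open>Sample space: independent fair signs for each finest step i = 1..2^L and each component j.\<close>
definition Omega :: "nat \<Rightarrow> (nat \<Rightarrow> 'm::finite \<Rightarrow> bool) set" where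
  "Omega L = PiE {1..2^L} (\<lambda>_. UNIV)"

definition sample_pmf :: "nat \<Rightarrow> (nat \<Rightarrow> 'm::finite \<Rightarrow> bool) pmf" where
  "sample_pmf L = pmf_of_set (Omega L)"

definition xi_finest :: "real \<Rightarrow> nat \<Rightarrow> (nat \<Rightarrow> 'm::finite \<Rightarrow> bool) \<Rightarrow> nat \<Rightarrow> real ^ 'm" where
  "xi_finest T L \<omega> i = (\<chi> j. sqrt (step_size T L) * (if \<omega> i j then 1 else -1))"

definition xi_fine :: "real \<Rightarrow> nat \<Rightarrow> nat \<Rightarrow> (nat \<Rightarrow> 'm::finite \<Rightarrow> bool) \<Rightarrow> nat \<Rightarrow> real ^ 'm" where
  "xi_fine T L l \<omega> i =
     (\<Sum>r\<in>{(i - 1) * 2 ^ (L - l) + 1 .. i * 2 ^ (L - l)}. xi_finest T L \<omega> r)"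

definition xi_coarse :: "real \<Rightarrow> nat \<Rightarrow> nat \<Rightarrow> (nat \<Rightarrow> 'm::finite \<Rightarrow> bool) \<Rightarrow> nat \<Rightarrow> real ^ 'm" where
  "xi_coarse T L l \<omega> i = xi_fine T L l \<omega> (2 * i - 1) + xi_fine T L l \<omega> (2 * i)"

definition xi_anti :: "real \<Rightarrow> nat \<Rightarrow> nat \<Rightarrow> (nat \<Rightarrow> 'm::finite \<Rightarrow> bool) \<Rightarrow> nat \<Rightarrow> real ^ 'm" where
  "xi_anti T L l \<omega> i = (if odd i then xi_fine T L l \<omega> (i + 1) else xi_fine T L l \<omega> (i - 1))"

text \<open>One step of the Milstein scheme without Levy areas; sigma_j'(x) sigma_k(x) is the
  Jacobian of sigma_j at x applied to sigma_k(x).\<close>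
definition milstein_step ::
  "(real^'d \<Rightarrow> real^'d) \<Rightarrow> ('m::finite \<Rightarrow> real^'d \<Rightarrow> real^'d) \<Rightarrow> real \<Rightarrow> real^'d \<Rightarrow> real^'m \<Rightarrow> real^'d" where
  "milstein_step \<mu> \<sigma> h x \<xi> =
     x + h *\<^sub>R \<mu> x + (\<Sum>j\<in>UNIV. (\<xi> $ j) *\<^sub>R \<sigma> j x)
     + (1/2) *\<^sub>R (\<Sum>j\<in>UNIV. \<Sum>k\<in>UNIV.
          ((\<xi> $ j) * (\<xi> $ k) - (if j = k then h else 0)) *\<^sub>R
            frechet_derivative (\<sigma> j) (at x) (\<sigma> k x))"

fun milstein ::
  "(real^'d \<Rightarrow> real^'d) \<Rightarrow> ('m::finite \<Rightarrow> real^'d \<Rightarrow> real^'d) \<Rightarrow> real \<Rightarrow> real^'d \<Rightarrow> (nat \<Rightarrow> real^'m) \<Rightarrow> nat \<Rightarrow> real^'d" where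
  "milstein \<mu> \<sigma> h X0 \<xi> 0 = X0"
| "milstein \<mu> \<sigma> h X0 \<xi> (Suc n) = milstein_step \<mu> \<sigma> h (milstein \<mu> \<sigma> h X0 \<xi> n) (\<xi> (Suc n))"

definition P_fine ::
  "(real^'d \<Rightarrow> real) \<Rightarrow> (real^'d \<Rightarrow> real^'d) \<Rightarrow> ('m::finite \<Rightarrow> real^'d \<Rightarrow> real^'d) \<Rightarrow> real^'d \<Rightarrow> real \<Rightarrow> nat \<Rightarrow> nat
   \<Rightarrow> (nat \<Rightarrow> 'm \<Rightarrow> bool) \<Rightarrow> real" where
  "P_fine f \<mu> \<sigma> X0 T L l \<omega> =
     (f (milstein \<mu> \<sigma> (step_size T l) X0 (xi_fine T L l \<omega>) (2 ^ l))
      + f (milstein \<mu> \<sigma> (step_size T l) X0 (xi_anti T L l \<omega>) (2 ^ l))) / 2"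

definition P_coarse ::
  "(real^'d \<Rightarrow> real) \<Rightarrow> (real^'d \<Rightarrow> real^'d) \<Rightarrow> ('m::finite \<Rightarrow> real^'d \<Rightarrow> real^'d) \<Rightarrow> real^'d \<Rightarrow> real \<Rightarrow> nat \<Rightarrow> nat
   \<Rightarrow> (nat \<Rightarrow> 'm \<Rightarrow> bool) \<Rightarrow> real" where
  "P_coarse f \<mu> \<sigma> X0 T L l \<omega> =
     f (milstein \<mu> \<sigma> (step_size T (l - 1)) X0 (xi_coarse T L l \<omega>) (2 ^ (l - 1)))"

end

(*
Write h for the fine step size and let x, y, w be the fine, antithetic and coarse paths at a coarse
grid point. All errors are controlled by the single Lyapunov function
  V = |(x+y)/2 - w|^2 + |x-w|^4 + |y-w|^4 + h^2 (1 + |x|^4 + |y|^4 + |w|^4),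
whose conditional expectation grows at most by a factor 1 + O(h) over one coarse step. It starts at
O(h^2), hence stays O(h^2) up to time T, and a second order Taylor expansion of the payoff bounds the
squared correction by a multiple of V.

Two fine steps equal one coarse step plus an antisymmetric Levy area term, a centred remainder of
size h^(3/2) and a drift remainder of size h^2. The Levy area terms of the fine and the antithetic
path have opposite signs, so in the average only their difference, of size h (|x-w| + |y-w|), survives.
The Milstein correction sigma_j' sigma_k is only locally Lipschitz (its second factor grows linearly);
since |x-w| and |y-w| are O(h^(1/2)) in L^4 and the correction is centred, no Gronwall argument
is ever applied to it: it is absorbed into the source terms of V.
*)
theory Submission
  imports Defs
begin

text \<open>The mixture of powers in V is forced by Taylor expansion. In the average of the fine and
  antithetic paths the linear terms cancel, and what remains is quadratic in x - w and y - w; the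
  square of the average error therefore calls for fourth powers of the single errors. The products h
  X |x - w| from the locally Lipschitz terms (X is one plus the norms of the paths) are split by s X
  t \<le> t^2 + s^2 X^2 with s = sqrt h, and the square of s^2 X^2 is the moment part of V. Every
  one-step estimate then has one form: a vector D is moved by a drift of size s^2 Y and a centred
  noise of size s Y, where Y dominates |D| and the relevant power of Y is at most a multiple of V.
  Centring removes the term linear in the noise, so the moment of order p grows only by O(s^2 Y^p).
  Uniformity in L: the increments enter only through mean, covariance and one moment bound on the
  normalised increment, the same for every number of summed signs. Since only terminal values
  matter, conditioning is plain integration over fresh signs with the past frozen.\<close>

lemma integral_pair_pmf_finite:
  fixes f :: "'a \<times> 'b \<Rightarrow> 'c::{banach, second_countable_topology}"
  assumes "finite (set_pmf p)" "finite (set_pmf q)"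
  shows "measure_pmf.expectation (pair_pmf p q) f
       = measure_pmf.expectation p (\<lambda>a. measure_pmf.expectation q (\<lambda>b. f (a, b)))"
proof -
  have "measure_pmf.expectation (pair_pmf p q) f
      = (\<Sum>z\<in>set_pmf p \<times> set_pmf q. pmf (pair_pmf p q) z *\<^sub>R f z)"
    using assms by (intro integral_measure_pmf) auto
  also have "\<dots> = (\<Sum>a\<in>set_pmf p. pmf p a *\<^sub>R (\<Sum>b\<in>set_pmf q. pmf q b *\<^sub>R f (a, b)))"
    by (simp add: scaleR_sum_right sum.cartesian_product case_prod_beta flip: pmf_pair)
  also have "\<dots> = (\<Sum>a\<in>set_pmf p. pmf p a *\<^sub>R measure_pmf.expectation q (\<lambda>b. f (a, b)))"
    by (intro sum.cong refl, subst integral_measure_pmf[OF assms(2)]) auto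
  also have "\<dots> = measure_pmf.expectation p (\<lambda>a. measure_pmf.expectation q (\<lambda>b. f (a, b)))"
    by (subst integral_measure_pmf[OF assms(1)]) auto
  finally show ?thesis .
qed

lemma integral_pair_pmf_finite_swap:
  fixes f :: "'a \<times> 'b \<Rightarrow> 'c::{banach, second_countable_topology}"
  assumes "finite (set_pmf p)" "finite (set_pmf q)"
  shows "measure_pmf.expectation (pair_pmf p q) f
       = measure_pmf.expectation q (\<lambda>b. measure_pmf.expectation p (\<lambda>a. f (a, b)))"
  using integral_pair_pmf_finite[OF assms(2,1), of "\<lambda>(b, a). f (a, b)"]
  by (subst pair_commute_pmf) (simp add: case_prod_beta')

lemma expectation_mono_finite:
  fixes f g :: "'a \<Rightarrow> real"
  assumes "finite (set_pmf p)" "\<And>x. f x \<le> g x"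
  shows "measure_pmf.expectation p f \<le> measure_pmf.expectation p g"
  using assms by (intro integral_mono integrable_measure_pmf_finite) auto

text \<open>The weight \<open>w\<close> of an increment satisfies \<open>|u| \<le> \<surd>h w\<close> and \<open>|u|\<^sup>2 \<le> h w\<close>,
  so all pointwise bounds below are powers of \<open>h\<close> times powers of weights; a fourth moment of the
  weight amounts to an eighth moment of the increment.\<close>

definition increment_weight :: "real \<Rightarrow> real^'m \<Rightarrow> real" where
  "increment_weight h u = 1 + (norm u)\<^sup>2 / h"

text \<open>This is all that the one-step analysis knows about an increment. Mean and covariance
  make the noise terms centred, the weight moment bounds their size, and \<open>\<kappa>\<close> is
  kept apart from \<open>h\<close> because it has to be the same for all levels.\<close>

definition increment_law :: "real \<Rightarrow> real \<Rightarrow> (real^'m) pmf \<Rightarrow> bool" where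
  "increment_law \<kappa> h p \<longleftrightarrow> finite (set_pmf p)
     \<and> (\<forall>j. measure_pmf.expectation p (\<lambda>u. u $ j) = 0)
     \<and> (\<forall>j k. measure_pmf.expectation p (\<lambda>u. u $ j * u $ k) = (if j = k then h else 0))
     \<and> measure_pmf.expectation p (\<lambda>u. increment_weight h u ^ 4) \<le> \<kappa>"

subsection \<open>Random signs\<close>

definition rsign :: "('m \<Rightarrow> bool) \<Rightarrow> 'm \<Rightarrow> real" where
  "rsign \<epsilon> j = (if \<epsilon> j then 1 else - 1)"

abbreviation signs_pmf :: "('m::finite \<Rightarrow> bool) pmf" where
  "signs_pmf \<equiv> pmf_of_set UNIV"

text \<open>Flipping one sign is an involution of the uniform sample space. Comparing a function
  with its flipped copy yields all one-step moments without any use of product measures.\<close>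

lemma expectation_signs_flip:
  fixes g :: "('m::finite \<Rightarrow> bool) \<Rightarrow> real"
  shows "measure_pmf.expectation signs_pmf g
       = measure_pmf.expectation signs_pmf (\<lambda>\<epsilon>. g (\<epsilon>(j := \<not> \<epsilon> j)))"
proof -
  have "bij (\<lambda>\<epsilon>::'m \<Rightarrow> bool. \<epsilon>(j := \<not> \<epsilon> j))"
    by (rule involuntory_imp_bij) auto
  then have "(\<Sum>\<epsilon>\<in>UNIV. g (\<epsilon>(j := \<not> \<epsilon> j))) = (\<Sum>\<epsilon>\<in>UNIV. g \<epsilon>)"
    by (rule sum.reindex_bij_betw)
  then show ?thesis
    by (simp add: integral_pmf_of_set)
qed

lemma expectation_rsign:
  fixes F :: "real \<Rightarrow> real" and j :: "'m::finite"
  shows "measure_pmf.expectation signs_pmf (\<lambda>\<epsilon>. F (rsign \<epsilon> j)) = (F 1 + F (-1)) / 2"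
proof -
  have int: "integrable signs_pmf G" for G :: "('m \<Rightarrow> bool) \<Rightarrow> real"
    by (rule integrable_measure_pmf_finite) simp
  let ?E = "measure_pmf.expectation signs_pmf (\<lambda>\<epsilon>. F (rsign \<epsilon> j))"
  \<comment> \<open>After doubling, the integrand is \<open>F 1 + F (-1)\<close> whichever value the
    sign takes, hence constant.\<close>
  have "?E + ?E = ?E + measure_pmf.expectation signs_pmf (\<lambda>\<epsilon>. F (rsign (\<epsilon>(j := \<not> \<epsilon> j)) j))"
    using expectation_signs_flip[of "\<lambda>\<epsilon>. F (rsign \<epsilon> j)" j] by simp
  also have "\<dots> = measure_pmf.expectation signs_pmf
      (\<lambda>\<epsilon>. F (rsign \<epsilon> j) + F (rsign (\<epsilon>(j := \<not> \<epsilon> j)) j))"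
    by (rule Bochner_Integration.integral_add[symmetric]) (rule int)+
  also have "\<dots> = measure_pmf.expectation signs_pmf (\<lambda>\<epsilon>::'m \<Rightarrow> bool. F 1 + F (-1))"
    by (rule Bochner_Integration.integral_cong) (auto simp: rsign_def)
  finally show ?thesis by simp
qed

lemma expectation_rsign_mult:
  fixes j k :: "'m::finite"
  shows "measure_pmf.expectation signs_pmf (\<lambda>\<epsilon>. rsign \<epsilon> j * rsign \<epsilon> k) = (if j = k then 1 else 0)"
proof (cases "j = k")
  case True
  have "measure_pmf.expectation signs_pmf (\<lambda>\<epsilon>. rsign \<epsilon> j * rsign \<epsilon> k)
      = measure_pmf.expectation signs_pmf (\<lambda>\<epsilon>::'m \<Rightarrow> bool. 1)"
    by (rule Bochner_Integration.integral_cong) (auto simp: rsign_def True)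
  then show ?thesis using True by simp
next
  case False
  have "measure_pmf.expectation signs_pmf (\<lambda>\<epsilon>. rsign \<epsilon> j * rsign \<epsilon> k)
      = measure_pmf.expectation signs_pmf (\<lambda>\<epsilon>. - (rsign \<epsilon> j * rsign \<epsilon> k))"
    by (subst expectation_signs_flip[of _ j], rule Bochner_Integration.integral_cong)
       (use False in \<open>auto simp: rsign_def\<close>)
  then show ?thesis using False by simp
qed

section \<open>Independent families of signs and the moments of their sums\<close>

abbreviation sign_paths :: "nat set \<Rightarrow> (nat \<Rightarrow> 'm::finite \<Rightarrow> bool) pmf" where
  "sign_paths I \<equiv> Pi_pmf I undefined (\<lambda>_. signs_pmf)"

lemma finite_set_sign_paths [simp]:
  "finite I \<Longrightarrow> finite (set_pmf (sign_paths I :: (nat \<Rightarrow> 'm::finite \<Rightarrow> bool) pmf))"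
  by (simp add: set_Pi_pmf finite_PiE_dflt)

text \<open>The uniform law on a finite product is the product of the uniform laws. The default
  value \<open>undefined\<close> outside the index set matches the extensional functions of
  \<open>Omega\<close>. The product form is the one that can be split along disjoint index
  sets.\<close>

lemma sample_pmf_eq_sign_paths:
  "(sample_pmf L :: (nat \<Rightarrow> 'm::finite \<Rightarrow> bool) pmf) = sign_paths {1..2 ^ L}"
proof -
  have "PiE_dflt {1..2 ^ L} undefined (\<lambda>_. UNIV) = (Omega L :: (nat \<Rightarrow> 'm \<Rightarrow> bool) set)"
    by (auto simp: PiE_dflt_def Omega_def PiE_def extensional_def)
  then show ?thesis
    by (simp add: sample_pmf_def Pi_pmf_of_set)
qed

lemma expectation_sign_paths_insert:
  fixes g :: "(nat \<Rightarrow> 'm::finite \<Rightarrow> bool) \<Rightarrow> real"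
  assumes "finite I" "i \<notin> I"
  shows "measure_pmf.expectation (sign_paths (insert i I)) g
       = measure_pmf.expectation (sign_paths I)
           (\<lambda>\<omega>. measure_pmf.expectation signs_pmf (\<lambda>\<epsilon>. g (fun_upd \<omega> i \<epsilon>)))"
  using assms by (simp add: Pi_pmf_insert integral_pair_pmf_finite_swap case_prod_beta)

text \<open>This plays the role of conditioning: the signs in \<open>I\<close> are the past, those
  in \<open>J\<close> are integrated with the past frozen.\<close>

lemma expectation_sign_paths_union:
  fixes g :: "(nat \<Rightarrow> 'm::finite \<Rightarrow> bool) \<Rightarrow> real"
  assumes "finite I" "finite J" "I \<inter> J = {}"
  shows "measure_pmf.expectation (sign_paths (I \<union> J)) g
       = measure_pmf.expectation (sign_paths I) (\<lambda>\<omega>. measure_pmf.expectation (sign_paths J)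
           (\<lambda>\<omega>'. g (\<lambda>i. if i \<in> I then \<omega> i else \<omega>' i)))"
  using assms by (simp add: Pi_pmf_union integral_pair_pmf_finite)

definition walk :: "nat set \<Rightarrow> (nat \<Rightarrow> 'm \<Rightarrow> bool) \<Rightarrow> 'm \<Rightarrow> real" where
  "walk I \<omega> j = (\<Sum>i\<in>I. rsign (\<omega> i) j)"

lemma walk_cong: "(\<And>i. i \<in> I \<Longrightarrow> \<omega> i = \<omega>' i) \<Longrightarrow> walk I \<omega> j = walk I \<omega>' j"
  by (simp add: walk_def)

lemma walk_insert:
  assumes "finite I" "i \<notin> I"
  shows "walk (insert i I) (fun_upd \<omega> i \<epsilon>) j = rsign \<epsilon> j + walk I \<omega> j"
proof -
  have "walk I (fun_upd \<omega> i \<epsilon>) j = walk I \<omega> j"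
    using assms by (intro walk_cong) auto
  then show ?thesis using assms by (simp add: walk_def)
qed

lemma expectation_walk:
  assumes "finite I"
  shows "measure_pmf.expectation (sign_paths I) (\<lambda>\<omega>. walk I \<omega> (j::'m::finite)) = 0"
  using assms
proof (induction I)
  case empty
  show ?case by (simp add: walk_def)
next
  case (insert i I)
  have "measure_pmf.expectation signs_pmf (\<lambda>\<epsilon>. rsign \<epsilon> j + c) = c" for c
    using expectation_rsign[of "\<lambda>x. x + c" j] by simp
  with insert show ?case
    by (simp add: expectation_sign_paths_insert walk_insert)
qed

lemma expectation_walk_mult:
  assumes "finite I"
  shows "measure_pmf.expectation (sign_paths I) (\<lambda>\<omega>. walk I \<omega> j * walk I \<omega> (k::'m::finite))
       = (if j = k then real (card I) else 0)"
  using assms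
proof (induction I)
  case empty
  show ?case by (simp add: walk_def)
next
  case (insert i I)
  have int: "integrable signs_pmf G" for G :: "('m \<Rightarrow> bool) \<Rightarrow> real"
    by (rule integrable_measure_pmf_finite) simp
  have zero: "measure_pmf.expectation signs_pmf (\<lambda>\<epsilon>. rsign \<epsilon> j) = 0" for j :: 'm
    using expectation_rsign[where F = "\<lambda>x. x"] by simp
  have step: "measure_pmf.expectation signs_pmf (\<lambda>\<epsilon>. (rsign \<epsilon> j + a) * (rsign \<epsilon> k + b))
      = (if j = k then 1 else 0) + a * b" for a b
    by (simp add: algebra_simps int zero expectation_rsign_mult)
  have intI: "integrable (sign_paths I) G" for G :: "(nat \<Rightarrow> 'm \<Rightarrow> bool) \<Rightarrow> real"
    by (rule integrable_measure_pmf_finite) (simp add: insert)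
  show ?case
    using insert by (simp add: expectation_sign_paths_insert walk_insert step intI)
qed

text \<open>Averaging over the newest sign removes the odd powers, so each even moment obeys a
  recursion in the lower even ones; hence all four bounds go through one induction. The constants 1,
  3, 15, 105 are the Gaussian moments, that is, the double factorials of 1, 3, 5, 7.\<close>

lemma walk_moments:
  fixes j :: "'m::finite"
  assumes "finite I"
  defines "M \<equiv> \<lambda>p. measure_pmf.expectation (sign_paths I) (\<lambda>\<omega>. walk I \<omega> j ^ p)"
  shows "M 2 = real (card I) \<and> M 4 \<le> 3 * real (card I) ^ 2 \<and> M 6 \<le> 15 * real (card I) ^ 3
       \<and> M 8 \<le> 105 * real (card I) ^ 4"
  using assms(1) unfolding M_def
proof (induction I)
  case empty
  show ?case by (simp add: walk_def)
next
  case (insert i I)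
  have intI: "integrable (sign_paths I) G" for G :: "(nat \<Rightarrow> 'm \<Rightarrow> bool) \<Rightarrow> real"
    by (rule integrable_measure_pmf_finite) (simp add: insert)
  let ?M = "\<lambda>p. measure_pmf.expectation (sign_paths I) (\<lambda>\<omega>. walk I \<omega> j ^ p)"
  let ?M' = "\<lambda>p. measure_pmf.expectation (sign_paths (insert i I)) (\<lambda>\<omega>. walk (insert i I) \<omega> j ^ p)"
  have *: "?M' p = measure_pmf.expectation (sign_paths I)
      (\<lambda>\<omega>. ((1 + walk I \<omega> j) ^ p + (- 1 + walk I \<omega> j) ^ p) / 2)" for p
    by (simp only: expectation_sign_paths_insert[OF insert.hyps] walk_insert[OF insert.hyps]
        expectation_rsign[of "\<lambda>x. (x + c) ^ p" j for c])
  have "((1 + x) ^ 2 + (- 1 + x) ^ 2) / 2 = x ^ 2 + 1" for x :: real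
    by (simp add: power2_eq_square algebra_simps)
  then have 2: "?M' 2 = ?M 2 + 1"
    by (simp add: * intI)
  have "((1 + x) ^ 4 + (- 1 + x) ^ 4) / 2 = x ^ 4 + 6 * x ^ 2 + 1" for x :: real
    by (simp add: eval_nat_numeral algebra_simps)
  then have 4: "?M' 4 = ?M 4 + 6 * ?M 2 + 1"
    by (simp add: * intI)
  have "((1 + x) ^ 6 + (- 1 + x) ^ 6) / 2 = x ^ 6 + 15 * x ^ 4 + 15 * x ^ 2 + 1" for x :: real
    by (simp add: eval_nat_numeral algebra_simps)
  then have 6: "?M' 6 = ?M 6 + 15 * ?M 4 + 15 * ?M 2 + 1"
    by (simp add: * intI)
  have "((1 + x) ^ 8 + (- 1 + x) ^ 8) / 2
      = x ^ 8 + 28 * x ^ 6 + 70 * x ^ 4 + 28 * x ^ 2 + 1" for x :: real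
    by (simp add: eval_nat_numeral algebra_simps)
  then have 8: "?M' 8 = ?M 8 + 28 * ?M 6 + 70 * ?M 4 + 28 * ?M 2 + 1"
    by (simp add: * intI)
  define n where "n = real (card I)"
  have n: "n \<ge> 0" and card: "real (card (insert i I)) = n + 1"
    using insert by (simp_all add: n_def)
  have "(n + 1) ^ 2 = n ^ 2 + 2 * n + 1" "(n + 1) ^ 3 = n ^ 3 + 3 * n ^ 2 + 3 * n + 1"
    "(n + 1) ^ 4 = n ^ 4 + 4 * n ^ 3 + 6 * n ^ 2 + 4 * n + 1"
    by (simp_all add: eval_nat_numeral algebra_simps)
  \<comment> \<open>With these bounds each recursion stays below the binomial expansion of the next
    power of \<open>n + 1\<close>; for order 8 the leading new term is 28 * 15 = 4 * 105 times
    \<open>n ^ 3\<close>, an exact match.\<close>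
  moreover have "?M 2 = n" "?M 4 \<le> 3 * n ^ 2" "?M 6 \<le> 15 * n ^ 3" "?M 8 \<le> 105 * n ^ 4"
    using insert.IH by (simp_all add: n_def)
  moreover have "0 \<le> n ^ 2" "0 \<le> n ^ 3"
    using n by simp_all
  ultimately show ?case
    unfolding card 2 4 6 8 using n by linarith
qed

lemma sum_power4_le:
  fixes a :: "'i::finite \<Rightarrow> real"
  assumes "\<And>i. 0 \<le> a i"
  shows "(\<Sum>i\<in>UNIV. a i) ^ 4 \<le> real CARD('i) ^ 4 * (\<Sum>i\<in>UNIV. a i ^ 4)"
proof -
  define m where "m = Max (range a)"
  obtain k where k: "m = a k"
    using Max_in[of "range a"] unfolding m_def by (metis UNIV_not_empty finite finite_imageI image_iff image_is_empty)
  have "(\<Sum>i\<in>UNIV. a i) \<le> (\<Sum>i\<in>(UNIV :: 'i set). m)"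
    by (intro sum_mono) (simp add: m_def)
  then have "(\<Sum>i\<in>UNIV. a i) ^ 4 \<le> (real CARD('i) * m) ^ 4"
    using assms by (intro power_mono sum_nonneg) auto
  also have "\<dots> = real CARD('i) ^ 4 * a k ^ 4"
    by (simp add: power_mult_distrib k)
  also have "\<dots> \<le> real CARD('i) ^ 4 * (\<Sum>i\<in>UNIV. a i ^ 4)"
    using assms by (intro mult_left_mono member_le_sum) auto
  finally show ?thesis .
qed

lemma one_plus_power4_le: "0 \<le> x \<Longrightarrow> (1 + x) ^ 4 \<le> 8 * (1 + x ^ 4)" for x :: real
proof -
  have "8 * (1 + x ^ 4) - (1 + x) ^ 4 = (x - 1)\<^sup>2 * (7 * x\<^sup>2 + 10 * x + 7)"
    by (simp add: eval_nat_numeral algebra_simps)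
  moreover assume "0 \<le> x"
  ultimately show ?thesis
    by (smt (verit) mult_nonneg_nonneg zero_le_power2)
qed

text \<open>The 8 comes from \<open>one_plus_power4_le\<close>, the 105 from the eighth moment of a
  walk. Four of the five factors \<open>CARD('m)\<close> are due to the fourth power of a sum over
  components, the fifth to summing their moments.\<close>

definition weight_bound :: "'m::finite itself \<Rightarrow> real" where
  "weight_bound _ = 8 * (1 + 105 * real CARD('m) ^ 5)"

text \<open>Independence of \<open>L\<close> is decided here. A sum over \<open>n\<close> finest
  steps is \<open>s\<close> times a walk of length \<open>n\<close> with
  \<open>h = s\<^sup>2 * n\<close>, so the weight depends only on the walk divided by
  \<open>sqrt n\<close>, whose eighth moment is bounded uniformly in \<open>n\<close>.\<close>

lemma increment_law_sum_xi_finest: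
  fixes L l :: nat and I :: "nat set" and T :: real
  assumes T: "T > 0" and I: "finite I" "card I = 2 ^ (L - l)" and l: "l \<le> L"
  shows "increment_law (weight_bound TYPE('m)) (step_size T l)
    (map_pmf (\<lambda>\<omega>. \<Sum>r\<in>I. xi_finest T L \<omega> r :: real^'m::finite) (sign_paths I))"
proof -
  define n where "n = real (card I)"
  define h where "h = step_size T l"
  define s where "s = sqrt (step_size T L)"
  have n: "n > 0"
    using I by (simp add: n_def)
  have s2: "s\<^sup>2 = step_size T L"
    using T by (simp add: s_def step_size_def)
  have h: "h = s\<^sup>2 * n"
  proof -
    have "(2::real) ^ L = 2 ^ l * 2 ^ (L - l)"
      using l by (simp flip: power_add)
    then show ?thesis
      unfolding s2 h_def n_def I(2) step_size_def by simp
  qed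
  have s: "s > 0"
    using T by (simp add: s_def step_size_def)
  have nth: "(\<Sum>r\<in>I. xi_finest T L \<omega> r :: real^'m) $ j = s * walk I \<omega> j" for \<omega> j
    by (simp add: xi_finest_def walk_def rsign_def s_def sum_distrib_left)
  have intI: "integrable (sign_paths I) G" for G :: "(nat \<Rightarrow> 'm \<Rightarrow> bool) \<Rightarrow> real"
    by (rule integrable_measure_pmf_finite) (simp add: I)
  have weight: "increment_weight h (\<Sum>r\<in>I. xi_finest T L \<omega> r :: real^'m) ^ 4
      \<le> 8 * (1 + real CARD('m) ^ 4 * (\<Sum>j\<in>UNIV. walk I \<omega> j ^ 8) / n ^ 4)" for \<omega>
  proof -
    define x where "x = (\<Sum>j\<in>UNIV. (walk I \<omega> (j::'m))\<^sup>2)"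
    have x: "x \<ge> 0" by (simp add: x_def sum_nonneg)
    have "(norm (\<Sum>r\<in>I. xi_finest T L \<omega> r :: real^'m))\<^sup>2 = s\<^sup>2 * x"
      unfolding norm_vec_def L2_set_def nth
      by (simp add: power_mult_distrib x_def sum_distrib_left sum_nonneg)
    then have "increment_weight h (\<Sum>r\<in>I. xi_finest T L \<omega> r :: real^'m) = 1 + x / n"
      using s by (simp add: increment_weight_def h)
    then have "increment_weight h (\<Sum>r\<in>I. xi_finest T L \<omega> r :: real^'m) ^ 4
        \<le> 8 * (1 + x ^ 4 / n ^ 4)"
      using one_plus_power4_le[of "x / n"] x n by (simp add: power_divide)
    also have "x ^ 4 \<le> real CARD('m) ^ 4 * (\<Sum>j\<in>UNIV. walk I \<omega> j ^ 8)"
      using sum_power4_le[of "\<lambda>j::'m. (walk I \<omega> j)\<^sup>2"] by (simp add: x_def flip: power_mult)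
    finally show ?thesis using n by (simp add: divide_right_mono)
  qed
  have "measure_pmf.expectation (sign_paths I)
      (\<lambda>\<omega>. increment_weight h (\<Sum>r\<in>I. xi_finest T L \<omega> r :: real^'m) ^ 4)
    \<le> measure_pmf.expectation (sign_paths I)
      (\<lambda>\<omega>. 8 * (1 + real CARD('m) ^ 4 * (\<Sum>j\<in>UNIV. walk I \<omega> (j::'m) ^ 8) / n ^ 4))"
    using weight I by (intro expectation_mono_finite) auto
  also have "\<dots> = 8 * (1 + real CARD('m) ^ 4 * (\<Sum>j\<in>(UNIV::'m set).
      measure_pmf.expectation (sign_paths I) (\<lambda>\<omega>. walk I \<omega> j ^ 8)) / n ^ 4)"
    by (simp add: intI)
  also have "\<dots> \<le> 8 * (1 + real CARD('m) ^ 4 * (\<Sum>j\<in>(UNIV::'m set). 105 * n ^ 4) / n ^ 4)"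
    using walk_moments[OF I(1)] n
    by (intro mult_left_mono add_left_mono divide_right_mono sum_mono) (auto simp: n_def)
  also have "\<dots> = weight_bound TYPE('m)"
    using n by (simp add: weight_bound_def eval_nat_numeral)
  finally have "measure_pmf.expectation (sign_paths I)
      (\<lambda>\<omega>. increment_weight h (\<Sum>r\<in>I. xi_finest T L \<omega> r :: real^'m) ^ 4) \<le> weight_bound TYPE('m)" .
  moreover have "measure_pmf.expectation (sign_paths I) (\<lambda>\<omega>. s * walk I \<omega> j * (s * walk I \<omega> k))
      = (if j = k then h else 0)" for j k :: 'm
  proof -
    have "measure_pmf.expectation (sign_paths I) (\<lambda>\<omega>. s * walk I \<omega> j * (s * walk I \<omega> k))
        = measure_pmf.expectation (sign_paths I) (\<lambda>\<omega>. s\<^sup>2 * (walk I \<omega> j * walk I \<omega> k))"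
      by (simp add: power2_eq_square ac_simps)
    then show ?thesis
      using expectation_walk_mult[OF I(1), of j k] by (simp add: h n_def)
  qed
  moreover have "measure_pmf.expectation (sign_paths I) (\<lambda>\<omega>. walk I \<omega> j) = 0" for j :: 'm
    by (rule expectation_walk[OF I(1)])
  ultimately show ?thesis
    using I unfolding increment_law_def h_def[symmetric]
    by (simp add: nth del: sum_component)
qed

subsection \<open>Pointwise estimates for one and two Milstein steps\<close>

text \<open>A quantitative form of \<open>C2_bounded\<close>: a Lipschitz derivative stands for the
  bounded second derivative, and the value at 0 turns the Lipschitz bound into linear growth with
  the same constant.\<close>

definition smooth_bounded ::
  "real \<Rightarrow> ('a::euclidean_space \<Rightarrow> 'b::euclidean_space) \<Rightarrow> ('a \<Rightarrow> 'a \<Rightarrow>\<^sub>L 'b) \<Rightarrow> bool" where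
  "smooth_bounded K g D \<longleftrightarrow>
     (\<forall>x. (g has_derivative blinfun_apply (D x)) (at x)) \<and> (\<forall>x. norm (D x) \<le> K)
     \<and> (\<forall>x y. norm (D x - D y) \<le> K * norm (x - y)) \<and> norm (g 0) \<le> K"

lemma blinfun_apply_bound: "norm D \<le> K \<Longrightarrow> norm (blinfun_apply D x) \<le> K * norm x"
  by (rule order_trans[OF norm_blinfun mult_right_mono]) auto

lemma smooth_bounded_lipschitz:
  assumes "smooth_bounded K g D"
  shows "norm (g x - g y) \<le> K * norm (x - y)"
proof (rule differentiable_bound[of UNIV g "\<lambda>x. blinfun_apply (D x)"])
  show "onorm (blinfun_apply (D x)) \<le> K" for x
    using assms by (simp add: smooth_bounded_def norm_blinfun.rep_eq)
qed (use assms in \<open>auto simp: smooth_bounded_def\<close>)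

text \<open>The derivative is chosen before \<open>K\<close>, and every large \<open>K\<close> is
  allowed, so that the drift, all diffusion coefficients and the payoff can later share one
  constant.\<close>

lemma C2_bounded_imp_smooth_bounded:
  assumes "C2_bounded g"
  shows "\<exists>K0 D. \<forall>K\<ge>K0. smooth_bounded K g D"
proof -
  obtain D D2 K1 where D: "\<And>x. (g has_derivative blinfun_apply (D x)) (at x)"
      "\<And>x. (D has_derivative blinfun_apply (D2 x)) (at x)"
      "\<And>x. norm (D x) \<le> K1" "\<And>x. norm (D2 x) \<le> K1"
    using assms unfolding C2_bounded_def by metis
  have lip: "norm (D x - D y) \<le> K1 * norm (x - y)" for x y
    by (rule differentiable_bound[of UNIV D "\<lambda>x. blinfun_apply (D2 x)"])
       (use D in \<open>auto simp: norm_blinfun.rep_eq\<close>)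
  have "smooth_bounded K g D" if K: "K \<ge> max K1 (norm (g 0))" for K
    unfolding smooth_bounded_def
  proof (intro conjI allI)
    show "norm (D x - D y) \<le> K * norm (x - y)" for x y
      by (rule order_trans[OF lip mult_right_mono]) (use K in auto)
    show "norm (D x) \<le> K" for x
      by (rule order_trans[OF D(3)]) (use K in auto)
  qed (use D(1) K in auto)
  then show ?thesis by blast
qed

context
  fixes K :: real and g :: "'a::euclidean_space \<Rightarrow> 'b::euclidean_space" and D
  assumes g: "smooth_bounded K g D"
begin

lemma smooth_bounded_nonneg: "K \<ge> 0"
  using g norm_ge_zero[of "g 0"] unfolding smooth_bounded_def by linarith

lemma smooth_bounded_growth: "norm (g x) \<le> K * (1 + norm x)"
proof -
  have "norm (g x) \<le> norm (g x - g 0) + norm (g 0)"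
    by norm
  also have "\<dots> \<le> K * norm (x - 0) + K"
    using smooth_bounded_lipschitz[OF g, of x 0] g by (intro add_mono) (auto simp: smooth_bounded_def)
  finally show ?thesis by (simp add: algebra_simps)
qed

lemma smooth_bounded_taylor:
  "norm (g y - g x - blinfun_apply (D x) (y - x)) \<le> K * (norm (y - x))\<^sup>2"
proof -
  have "norm (g y - g x - blinfun_apply (D x) (y - x)) \<le> norm (y - x) * (K * norm (y - x))"
  proof (rule differentiable_bound_linearization[where S = "closed_segment x y"
        and f' = "\<lambda>x. blinfun_apply (D x)"])
    show "x + t *\<^sub>R (y - x) \<in> closed_segment x y" if "t \<in> {0..1}" for t
      using that by (auto simp: in_segment algebra_simps intro!: exI[of _ t])
    show "(g has_derivative blinfun_apply (D z)) (at z within closed_segment x y)" for z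
      using g by (auto simp: smooth_bounded_def intro: has_derivative_at_withinI)
    show "onorm (blinfun_apply (D z) - blinfun_apply (D x)) \<le> K * norm (y - x)"
      if "z \<in> closed_segment x y" for z
    proof -
      have "blinfun_apply (D z) - blinfun_apply (D x) = blinfun_apply (D z - D x)"
        by (auto simp: blinfun.diff_left)
      then have "onorm (blinfun_apply (D z) - blinfun_apply (D x)) = norm (D z - D x)"
        by (simp add: norm_blinfun.rep_eq)
      also have "\<dots> \<le> K * norm (z - x)"
        using g by (simp add: smooth_bounded_def)
      also have "\<dots> \<le> K * norm (y - x)"
        using segment_bound1[OF that] smooth_bounded_nonneg
        by (intro mult_left_mono) (auto simp: norm_minus_commute)
      finally show ?thesis .
    qed
  qed simp
  then show ?thesis by (simp add: power2_eq_square ac_simps)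
qed

text \<open>Expanding at the midpoint, the two first order terms are opposite and cancel, which
  leaves the two Taylor remainders. This cancellation is the source of the antithetic gain.\<close>

lemma smooth_bounded_midpoint:
  "norm ((1/2) *\<^sub>R (g x + g y) - g ((1/2) *\<^sub>R (x + y))) \<le> K * (norm (x - y))\<^sup>2"
proof -
  define z where "z = (1/2) *\<^sub>R (x + y)"
  have "z + z = x + y"
    by (simp add: z_def flip: scaleR_2)
  then have yz: "y - z = - (x - z)" and "x - y = (x - z) + (x - z)"
    by (simp_all add: algebra_simps)
  then have xz: "x - z = (1/2) *\<^sub>R (x - y)"
    by (simp only: scaleR_half_double)
  have nx: "(norm (x - z))\<^sup>2 \<le> (norm (x - y))\<^sup>2"
    unfolding xz by (intro power_mono) auto
  have "(1/2) *\<^sub>R (g x + g y) - g z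
      = (1/2) *\<^sub>R ((g x - g z - blinfun_apply (D z) (x - z)) + (g y - g z - blinfun_apply (D z) (y - z)))"
  proof -
    have "(1/2) *\<^sub>R ((p - r - d) + (q - r - - d)) = (1/2) *\<^sub>R (p + q) - r" for p q r d :: 'b
    proof -
      have "(p - r - d) + (q - r - - d) = (p + q) - (r + r)"
        by simp
      then show ?thesis by (simp only: scaleR_diff_right scaleR_half_double)
    qed
    then show ?thesis unfolding yz blinfun.minus_right by simp
  qed
  also have "norm \<dots> \<le> (1/2) * (K * (norm (x - z))\<^sup>2 + K * (norm (y - z))\<^sup>2)"
    unfolding norm_scaleR
    by (intro mult_mono norm_triangle_le add_mono smooth_bounded_taylor) auto
  also have "\<dots> = K * (norm (x - z))\<^sup>2"
    unfolding yz by (simp add: norm_minus_commute)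
  also have "\<dots> \<le> K * (norm (x - y))\<^sup>2"
    using nx smooth_bounded_nonneg by (intro mult_left_mono)
  finally show ?thesis unfolding z_def .
qed

end

lemma norm_sum_components_le:
  fixes a :: "'m::finite \<Rightarrow> 'b::real_normed_vector" and u :: "real^'m"
  assumes "\<And>j. norm (a j) \<le> B"
  shows "norm (\<Sum>j\<in>UNIV. (u $ j) *\<^sub>R a j) \<le> real CARD('m) * (norm u * B)"
proof -
  have "norm (\<Sum>j\<in>UNIV. (u $ j) *\<^sub>R a j) \<le> (\<Sum>j\<in>(UNIV :: 'm set). norm u * B)"
    using assms by (intro sum_norm_le) (auto intro!: mult_mono component_le_norm_cart)
  then show ?thesis by simp
qed

lemma norm_double_sum_le:
  fixes a :: "'m::finite \<Rightarrow> 'm \<Rightarrow> 'b::real_normed_vector" and q :: "'m \<Rightarrow> 'm \<Rightarrow> real"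
  assumes "\<And>j k. norm (a j k) \<le> B" "\<And>j k. \<bar>q j k\<bar> \<le> M"
  shows "norm (\<Sum>j\<in>UNIV. \<Sum>k\<in>UNIV. q j k *\<^sub>R a j k) \<le> (real CARD('m))\<^sup>2 * (M * B)"
proof -
  have "0 \<le> M"
    using order_trans[OF abs_ge_zero assms(2)] .
  then have "norm (\<Sum>j\<in>UNIV. \<Sum>k\<in>UNIV. q j k *\<^sub>R a j k) \<le> (\<Sum>j\<in>(UNIV :: 'm set). \<Sum>k\<in>(UNIV :: 'm set). M * B)"
    using assms by (intro sum_norm_le) (auto intro!: mult_mono)
  then show ?thesis by (simp add: power2_eq_square)
qed

lemma scaleR_double: "(2 * h) *\<^sub>R z = h *\<^sub>R z + h *\<^sub>R z" for z :: "'a::real_vector"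
  by (metis mult_2 scaleR_add_left)

lemma increment_weight_ge_1: "h > 0 \<Longrightarrow> 1 \<le> increment_weight h u"
  by (simp add: increment_weight_def)

lemma norm_le_increment_weight:
  assumes "s > 0"
  shows "norm u \<le> s * increment_weight (s\<^sup>2) u"
proof -
  have "norm u / s \<le> 1 + (norm u / s)\<^sup>2"
    using zero_le_power2[of "norm u / s - 1 / 2"] by (simp add: power2_diff power_divide)
  then have "s * (norm u / s) \<le> s * (1 + (norm u / s)\<^sup>2)"
    using assms by (intro mult_left_mono) auto
  then show ?thesis
    using assms by (simp add: increment_weight_def power_divide)
qed

lemma increment_weight_scaled: "h > 0 \<Longrightarrow> h * increment_weight h u = h + (norm u)\<^sup>2"
  by (simp add: increment_weight_def field_simps)

text \<open>\<open>\<tau>\<close> bounds the square root of every step size: a surplus factor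
  \<open>s\<close> in an estimate is replaced by \<open>\<tau>\<close>, so step sizes above 1 are
  covered too. Taking \<open>K\<close> and \<open>\<tau>\<close> at least 1 allows lower powers of
  constants to be absorbed into higher ones.\<close>

locale milstein_coefficients =
  fixes \<mu> :: "real^'d \<Rightarrow> real^'d" and \<sigma> :: "'m::finite \<Rightarrow> real^'d \<Rightarrow> real^'d"
    and D\<mu> :: "real^'d \<Rightarrow> (real^'d) \<Rightarrow>\<^sub>L (real^'d)"
    and D\<sigma> :: "'m \<Rightarrow> real^'d \<Rightarrow> (real^'d) \<Rightarrow>\<^sub>L (real^'d)"
    and K \<tau> :: real
  assumes K: "K \<ge> 1" and \<tau>: "\<tau> \<ge> 1"
    and \<mu>: "smooth_bounded K \<mu> D\<mu>" and \<sigma>: "\<And>j. smooth_bounded K (\<sigma> j) (D\<sigma> j)"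
begin

section \<open>The terms of a single step and their growth and Lipschitz bounds\<close>

definition b :: real where "b = real CARD('m) * K"

definition drive :: "real^'d \<Rightarrow> real^'m \<Rightarrow> real^'d" where
  "drive x u = (\<Sum>j\<in>UNIV. (u $ j) *\<^sub>R \<sigma> j x)"

definition G :: "'m \<Rightarrow> 'm \<Rightarrow> real^'d \<Rightarrow> real^'d" where
  "G j k x = blinfun_apply (D\<sigma> j x) (\<sigma> k x)"

definition corr :: "real \<Rightarrow> real^'d \<Rightarrow> real^'m \<Rightarrow> real^'d" where
  "corr h x u = (1/2) *\<^sub>R (\<Sum>j\<in>UNIV. \<Sum>k\<in>UNIV. ((u $ j) * (u $ k) - (if j = k then h else 0)) *\<^sub>R G j k x)"

text \<open>Not symmetrised on purpose: expanding the noise of the second step along that of the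
  first produces it with arguments \<open>v\<close>, \<open>u\<close> in this order. Its symmetric
  part belongs to the coarse correction, its antisymmetric part is \<open>levy\<close>.\<close>

definition cross :: "real^'d \<Rightarrow> real^'m \<Rightarrow> real^'m \<Rightarrow> real^'d" where
  "cross x u v = (\<Sum>j\<in>UNIV. \<Sum>k\<in>UNIV. ((u $ j) * (v $ k)) *\<^sub>R G j k x)"

definition step :: "real \<Rightarrow> real^'d \<Rightarrow> real^'m \<Rightarrow> real^'d" where
  "step h x u = x + h *\<^sub>R \<mu> x + drive x u + corr h x u"

lemma milstein_step_eq: "milstein_step \<mu> \<sigma> h x u = step h x u"
proof -
  have "frechet_derivative (\<sigma> j) (at x) = blinfun_apply (D\<sigma> j x)" for j
    using \<sigma>[of j] by (auto simp: smooth_bounded_def intro: frechet_derivative_at[symmetric])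
  then show ?thesis
    by (simp add: milstein_step_def step_def drive_def corr_def G_def)
qed

lemma card_ge_1: "1 \<le> real CARD('m)"
  by (simp add: Suc_leI)

lemma b_ge: "1 \<le> b" "K \<le> b"
  using K card_ge_1 mult_mono[of 1 "real CARD('m)" 1 K] mult_right_mono[of 1 "real CARD('m)" K]
  by (auto simp: b_def)

lemma drift_bound: "norm (\<mu> x) \<le> b * (1 + norm x)"
  by (rule order_trans[OF smooth_bounded_growth[OF \<mu>] mult_right_mono]) (use b_ge in auto)

lemma drift_lipschitz: "norm (\<mu> x - \<mu> y) \<le> b * norm (x - y)"
  by (rule order_trans[OF smooth_bounded_lipschitz[OF \<mu>] mult_right_mono]) (use b_ge in auto)

lemma drive_bound: "norm (drive x u) \<le> b * (1 + norm x) * norm u"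
  using norm_sum_components_le[of "\<lambda>j. \<sigma> j x" "K * (1 + norm x)" u] smooth_bounded_growth[OF \<sigma>]
  by (simp add: drive_def b_def ac_simps)

lemma drive_diff: "drive x u - drive y u = (\<Sum>j\<in>UNIV. (u $ j) *\<^sub>R (\<sigma> j x - \<sigma> j y))"
  by (simp add: drive_def scaleR_diff_right sum_subtractf)

lemma drive_lipschitz: "norm (drive x u - drive y u) \<le> b * norm (x - y) * norm u"
  using norm_sum_components_le[of "\<lambda>j. \<sigma> j x - \<sigma> j y" "K * norm (x - y)" u] smooth_bounded_lipschitz[OF \<sigma>]
  by (simp add: drive_diff b_def ac_simps)

lemma drive_add: "drive x (u + v) = drive x u + drive x v"
  by (simp add: drive_def scaleR_add_left sum.distrib)

lemma D\<sigma>_bound: "norm (blinfun_apply (D\<sigma> j x) z) \<le> K * norm z"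
  using \<sigma>[of j] by (intro blinfun_apply_bound) (auto simp: smooth_bounded_def)

lemma D\<mu>_bound: "norm (blinfun_apply (D\<mu> x) z) \<le> K * norm z"
  using \<mu> by (intro blinfun_apply_bound) (auto simp: smooth_bounded_def)

lemma G_bound: "norm (G j k x) \<le> K\<^sup>2 * (1 + norm x)"
proof -
  have "norm (G j k x) \<le> K * (K * (1 + norm x))"
    unfolding G_def
    by (rule order_trans[OF D\<sigma>_bound mult_left_mono]) (use K smooth_bounded_growth[OF \<sigma>] in auto)
  then show ?thesis by (simp add: power2_eq_square ac_simps)
qed

text \<open>The difference of products is split so that the growing factor \<open>\<sigma> k\<close>
  is evaluated at \<open>x\<close>; only the norm of \<open>x\<close> then appears, whatever the
  size of \<open>y\<close>.\<close>

lemma G_lipschitz: "norm (G j k x - G j k y) \<le> 2 * K\<^sup>2 * (1 + norm x) * norm (x - y)"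
proof -
  have "G j k x - G j k y = blinfun_apply (D\<sigma> j x - D\<sigma> j y) (\<sigma> k x) + blinfun_apply (D\<sigma> j y) (\<sigma> k x - \<sigma> k y)"
    by (simp add: G_def blinfun.diff_left blinfun.diff_right)
  also have "norm \<dots> \<le> (K * norm (x - y)) * (K * (1 + norm x)) + K * (K * norm (x - y))"
  proof (intro norm_triangle_le add_mono)
    have "norm (blinfun_apply (D\<sigma> j x - D\<sigma> j y) (\<sigma> k x)) \<le> (K * norm (x - y)) * norm (\<sigma> k x)"
      using \<sigma>[of j] by (intro blinfun_apply_bound) (auto simp: smooth_bounded_def)
    also have "\<dots> \<le> (K * norm (x - y)) * (K * (1 + norm x))"
      using K smooth_bounded_growth[OF \<sigma>] by (intro mult_left_mono) auto
    finally show "norm (blinfun_apply (D\<sigma> j x - D\<sigma> j y) (\<sigma> k x)) \<le> \<dots>" .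
    show "norm (blinfun_apply (D\<sigma> j y) (\<sigma> k x - \<sigma> k y)) \<le> K * (K * norm (x - y))"
      by (rule order_trans[OF D\<sigma>_bound mult_left_mono]) (use K smooth_bounded_lipschitz[OF \<sigma>] in auto)
  qed
  also have "\<dots> = K\<^sup>2 * (2 + norm x) * norm (x - y)"
    by (simp add: power2_eq_square algebra_simps)
  also have "\<dots> \<le> K\<^sup>2 * (2 * (1 + norm x)) * norm (x - y)"
    by (intro mult_right_mono mult_left_mono) auto
  finally show ?thesis by (simp add: algebra_simps)
qed

lemma corr_coefficient_le:
  assumes "h > 0"
  shows "\<bar>(u $ j) * (u $ k) - (if j = k then h else 0)\<bar> \<le> h * increment_weight h u"
proof -
  have "\<bar>u $ j * u $ k\<bar> \<le> (norm u)\<^sup>2"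
    by (simp add: abs_mult power2_eq_square mult_mono component_le_norm_cart)
  then have "\<bar>u $ j * u $ k\<bar> + h \<le> h * increment_weight h u"
    using assms by (simp add: increment_weight_scaled)
  then show ?thesis
    using assms abs_triangle_ineq4[of "u $ j * u $ k" h] by (cases "j = k") simp_all
qed

lemma half_scaleR_le: "norm x \<le> B \<Longrightarrow> norm ((1/2) *\<^sub>R x) \<le> B"
  using norm_ge_zero[of x] by (simp del: norm_ge_zero)

lemma corr_bound:
  assumes "h > 0"
  shows "norm (corr h x u) \<le> b\<^sup>2 * (1 + norm x) * (h * increment_weight h u)"
  using norm_double_sum_le[of "\<lambda>j k. G j k x" "K\<^sup>2 * (1 + norm x)" _ "h * increment_weight h u",
      OF G_bound corr_coefficient_le[OF assms]]
  unfolding corr_def by (intro half_scaleR_le) (simp add: b_def power_mult_distrib ac_simps)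

lemma corr_diff: "corr h x u - corr h y u = (1/2) *\<^sub>R (\<Sum>j\<in>UNIV. \<Sum>k\<in>UNIV.
    ((u $ j) * (u $ k) - (if j = k then h else 0)) *\<^sub>R (G j k x - G j k y))"
  by (simp only: corr_def scaleR_diff_right sum_subtractf)

lemma corr_lipschitz:
  assumes "h > 0"
  shows "norm (corr h x u - corr h y u) \<le> 2 * b\<^sup>2 * (1 + norm x) * norm (x - y) * (h * increment_weight h u)"
  using norm_double_sum_le[of "\<lambda>j k. G j k x - G j k y" "2 * K\<^sup>2 * (1 + norm x) * norm (x - y)" _
      "h * increment_weight h u", OF G_lipschitz corr_coefficient_le[OF assms]]
  unfolding corr_diff by (intro half_scaleR_le) (simp add: b_def power_mult_distrib ac_simps)

lemma cross_lipschitz: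
  "norm (cross x u v - cross y u v) \<le> 2 * b\<^sup>2 * (1 + norm x) * norm (x - y) * (norm u * norm v)"
proof -
  have "\<bar>u $ j * v $ k\<bar> \<le> norm u * norm v" for j k
    by (simp add: abs_mult mult_mono component_le_norm_cart)
  from norm_double_sum_le[of "\<lambda>j k. G j k x - G j k y", OF G_lipschitz this]
  have "norm (\<Sum>j\<in>UNIV. \<Sum>k\<in>UNIV. (u $ j * v $ k) *\<^sub>R (G j k x - G j k y))
      \<le> 2 * b\<^sup>2 * (1 + norm x) * norm (x - y) * (norm u * norm v)"
    by (simp add: b_def power_mult_distrib ac_simps)
  then show ?thesis
    by (simp only: cross_def scaleR_diff_right sum_subtractf)
qed

text \<open>The doubled compensator splits evenly between the two halves, so only the mixed products
  of \<open>u\<close> and \<open>v\<close> are left over, and they enter symmetrically.\<close>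

lemma corr_add: "corr (2 * h) x (u + v) = corr h x u + corr h x v + (1/2) *\<^sub>R (cross x u v + cross x v u)"
proof -
  have "((u + v) $ j * (u + v) $ k - (if j = k then 2 * h else 0)) *\<^sub>R G j k x
      = (u $ j * u $ k - (if j = k then h else 0)) *\<^sub>R G j k x
        + (v $ j * v $ k - (if j = k then h else 0)) *\<^sub>R G j k x
        + ((u $ j * v $ k) *\<^sub>R G j k x + (v $ j * u $ k) *\<^sub>R G j k x)" for j k
    unfolding scaleR_add_left[symmetric] by (simp add: algebra_simps)
  then show ?thesis
    unfolding corr_def cross_def by (simp only: sum.distrib scaleR_add_right)
qed

lemma sum_D\<sigma>_drive: "(\<Sum>j\<in>UNIV. (v $ j) *\<^sub>R blinfun_apply (D\<sigma> j x) (drive x u)) = cross x v u"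
  by (simp add: cross_def drive_def G_def blinfun.sum_right blinfun.scaleR_right scaleR_sum_right)

section \<open>Two fine steps compared with one coarse step\<close>

definition crude_drift :: "real \<Rightarrow> real^'d \<Rightarrow> real^'m \<Rightarrow> real^'d" where
  "crude_drift h x u = h *\<^sub>R (\<mu> (step h x u) - \<mu> x)"

definition crude_noise :: "real \<Rightarrow> real^'d \<Rightarrow> real^'m \<Rightarrow> real^'m \<Rightarrow> real^'d" where
  "crude_noise h x u v = corr h x u + (drive (step h x u) v - drive x v) + corr h (step h x u) v"

text \<open>The crude decomposition has remainders growing linearly in \<open>x\<close> and is used for fourth moments;
  the fine one below gains a factor \<open>\<surd>h\<close> at the price of quadratic growth and is used for second
  moments. Both therefore need only fourth moments of the scheme.\<close>

lemma two_step_crude: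
  "step h (step h x u) v
   = x + ((2 * h) *\<^sub>R \<mu> x + crude_drift h x u) + (drive x (u + v) + crude_noise h x u v)"
proof -
  have "step h (step h x u) v
      = step h x u + h *\<^sub>R \<mu> (step h x u) + drive (step h x u) v + corr h (step h x u) v"
    by (rule step_def)
  moreover have "step h x u = x + h *\<^sub>R \<mu> x + drive x u + corr h x u"
    by (rule step_def)
  ultimately show ?thesis
    by (simp add: crude_drift_def crude_noise_def drive_add scaleR_diff_right scaleR_double)
qed

text \<open>In components this is half the sum of
  \<open>(v $ j * u $ k - u $ j * v $ k) *\<^sub>R G j k x\<close>: the discrete Levy area of the
  two increments paired with the Lie brackets of the diffusion coefficients. A coarse step sees only
  \<open>u + v\<close> and cannot reproduce it.\<close>

definition levy :: "real^'d \<Rightarrow> real^'m \<Rightarrow> real^'m \<Rightarrow> real^'d" where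
  "levy x u v = (1/2) *\<^sub>R (cross x v u - cross x u v)"

text \<open>The leading part of the change of the drift, \<open>h\<close> times the derivative of
  \<open>\<mu>\<close> along \<open>drive x u\<close>, has size h^(3/2), too large for a drift
  remainder. It is centred, so it is moved to \<open>fine_noise\<close>, and a term of size h^2
  stays here.\<close>

definition fine_drift :: "real \<Rightarrow> real^'d \<Rightarrow> real^'m \<Rightarrow> real^'d" where
  "fine_drift h x u = h *\<^sub>R (\<mu> (step h x u) - \<mu> x - blinfun_apply (D\<mu> x) (drive x u))"

definition fine_noise :: "real \<Rightarrow> real^'d \<Rightarrow> real^'m \<Rightarrow> real^'m \<Rightarrow> real^'d" where
  "fine_noise h x u v =
     (\<Sum>j\<in>UNIV. (v $ j) *\<^sub>R (\<sigma> j (step h x u) - \<sigma> j x - blinfun_apply (D\<sigma> j x) (drive x u)))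
     + (corr h (step h x u) v - corr h x v) + h *\<^sub>R blinfun_apply (D\<mu> x) (drive x u)"

lemma levy_swap: "levy x v u = - levy x u v"
  by (simp add: levy_def algebra_simps)

lemma two_step_fine:
  "step h (step h x u) v
   = step (2 * h) x (u + v) + levy x u v + fine_noise h x u v + fine_drift h x u"
proof -
  define y where "y = step h x u"
  have "fine_noise h x u v = drive y v - drive x v - cross x v u + (corr h y v - corr h x v)
      + h *\<^sub>R blinfun_apply (D\<mu> x) (drive x u)"
    unfolding fine_noise_def y_def drive_diff
    by (simp add: scaleR_diff_right sum_subtractf sum_D\<sigma>_drive)
  moreover have "step h y v = x + h *\<^sub>R \<mu> x + drive x u + corr h x u + h *\<^sub>R \<mu> y + drive y v + corr h y v"
    unfolding step_def[of h y v] by (simp add: y_def step_def)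
  \<comment> \<open>The linearised change of the second noise is \<open>cross x v u\<close>. The
    coarse correction supplies its symmetric part, \<open>levy\<close> the rest.\<close>
  moreover have "(1/2) *\<^sub>R (cross x u v + cross x v u) + levy x u v = cross x v u"
    unfolding levy_def scaleR_add_right[symmetric] by (simp add: scaleR_half_double)
  moreover have "step (2 * h) x (u + v) = x + (h *\<^sub>R \<mu> x + h *\<^sub>R \<mu> x) + (drive x u + drive x v)
      + (corr h x u + corr h x v + (1/2) *\<^sub>R (cross x u v + cross x v u))"
    by (simp add: step_def corr_add drive_add scaleR_double)
  moreover have "fine_drift h x u = h *\<^sub>R \<mu> y - h *\<^sub>R \<mu> x - h *\<^sub>R blinfun_apply (D\<mu> x) (drive x u)"
    by (simp add: fine_drift_def y_def scaleR_diff_right)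
  ultimately show ?thesis
    unfolding y_def[symmetric] by (simp only:) (simp add: algebra_simps)
qed

text \<open>The constants that the estimates below produce: \<open>\<beta>\<close> for the
  displacement of one step, \<open>\<gamma>\<close> for the growth of \<open>1 + norm x\<close> over
  it, \<open>\<kappa>1\<close> and \<open>\<kappa>2\<close> for the crude and the fine remainders.
  The three summands of \<open>\<kappa>1\<close> and of \<open>\<kappa>2\<close> correspond to the
  three terms of \<open>crude_noise\<close> and of \<open>fine_noise\<close>.\<close>

definition \<beta> :: real where "\<beta> = 3 * b\<^sup>2 * \<tau>"
definition \<gamma> :: real where "\<gamma> = 1 + \<beta> * \<tau>"
definition \<kappa>1 :: real where "\<kappa>1 = b\<^sup>2 + b * \<beta> + b\<^sup>2 * \<gamma>"
definition \<kappa>2 :: real where "\<kappa>2 = b * (\<beta>\<^sup>2 + 2 * b\<^sup>2) + 2 * b\<^sup>2 * \<beta> + b\<^sup>2"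

lemma constants_ge: "b \<le> b\<^sup>2" "1 \<le> b\<^sup>2" "1 \<le> \<beta>" "1 \<le> \<gamma>" "1 \<le> \<kappa>1" "1 \<le> \<kappa>2" "0 \<le> \<tau>"
proof -
  note b = b_ge(1)
  show 1: "b \<le> b\<^sup>2" "1 \<le> b\<^sup>2"
    using b by (simp_all add: self_le_power)
  have "1 * 1 \<le> b\<^sup>2 * \<tau>"
    using 1 \<tau> by (intro mult_mono) auto
  then show 2: "1 \<le> \<beta>" by (simp add: \<beta>_def)
  show 3: "0 \<le> \<tau>" using \<tau> by simp
  show 4: "1 \<le> \<gamma>" using 2 3 by (simp add: \<gamma>_def)
  show "1 \<le> \<kappa>1" using 1 2 4 b by (simp add: \<kappa>1_def add_increasing2)
  show "1 \<le> \<kappa>2" using 1 2 4 b by (simp add: \<kappa>2_def add_increasing)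
qed

section \<open>Sizes of the remainders in powers of the root of the step size\<close>

context
  fixes s :: real
  assumes s: "0 < s" "s \<le> \<tau>"
begin

abbreviation wt :: "real^'m \<Rightarrow> real" where "wt u \<equiv> increment_weight (s\<^sup>2) u"

lemma wt_ge_1: "1 \<le> wt u"
  using s by (intro increment_weight_ge_1) auto

lemma norm_le_wt: "norm u \<le> s * wt u"
  using s by (intro norm_le_increment_weight) auto

lemma wt_le_prod: "wt u \<le> wt u * wt v" "wt v \<le> wt u * wt v" "1 \<le> wt u * wt v"
    "wt u * wt v \<le> (wt u * wt v)\<^sup>2"
proof -
  show 1: "wt u \<le> wt u * wt v" "wt v \<le> wt u * wt v"
    using mult_left_mono[of 1 "wt v" "wt u"] mult_right_mono[of 1 "wt u" "wt v"]
      wt_ge_1[of u] wt_ge_1[of v] by auto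
  show 2: "1 \<le> wt u * wt v"
    using 1 wt_ge_1[of u] by linarith
  show "wt u * wt v \<le> (wt u * wt v)\<^sup>2"
    using mult_left_mono[OF 2, of "wt u * wt v"] 2 by (simp add: power2_eq_square)
qed

lemma drift_corr_bound: "norm (s\<^sup>2 *\<^sub>R \<mu> x + corr (s\<^sup>2) x u) \<le> 2 * b\<^sup>2 * (1 + norm x) * (s\<^sup>2 * wt u)"
proof -
  have "norm (s\<^sup>2 *\<^sub>R \<mu> x) \<le> b\<^sup>2 * (1 + norm x) * (s\<^sup>2 * wt u)"
  proof -
    have "norm (s\<^sup>2 *\<^sub>R \<mu> x) \<le> s\<^sup>2 * (b * (1 + norm x))"
      using drift_bound by (simp add: mult_left_mono)
    also have "\<dots> = b * (1 + norm x) * (s\<^sup>2 * 1)" by simp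
    also have "\<dots> \<le> b\<^sup>2 * (1 + norm x) * (s\<^sup>2 * wt u)"
      using constants_ge b_ge wt_ge_1 by (intro mult_mono) auto
    finally show ?thesis .
  qed
  moreover have "norm (corr (s\<^sup>2) x u) \<le> b\<^sup>2 * (1 + norm x) * (s\<^sup>2 * wt u)"
    using corr_bound[of "s\<^sup>2"] s by simp
  ultimately show ?thesis
    using norm_triangle_ineq[of "s\<^sup>2 *\<^sub>R \<mu> x" "corr (s\<^sup>2) x u"] by simp
qed

lemma drive_bound_wt: "norm (drive x u) \<le> b * (1 + norm x) * (s * wt u)"
  by (rule order_trans[OF drive_bound mult_left_mono[OF norm_le_wt]]) (use b_ge in auto)

lemma step_diff_bound: "norm (step (s\<^sup>2) x u - x) \<le> \<beta> * (1 + norm x) * (s * wt u)"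
proof -
  have "norm (step (s\<^sup>2) x u - x) \<le> norm (s\<^sup>2 *\<^sub>R \<mu> x + corr (s\<^sup>2) x u) + norm (drive x u)"
  proof -
    have "step (s\<^sup>2) x u - x = (s\<^sup>2 *\<^sub>R \<mu> x + corr (s\<^sup>2) x u) + drive x u"
      by (simp add: step_def)
    then show ?thesis by (simp only: norm_triangle_ineq)
  qed
  \<comment> \<open>One factor of \<open>s\<^sup>2\<close> is traded for \<open>\<tau>\<close>, and
    the drive is enlarged to the same shape; two parts plus one part give the 3 in
    \<open>\<beta>\<close>.\<close>
  also have "\<dots> \<le> 2 * b\<^sup>2 * (1 + norm x) * (\<tau> * s * wt u) + b\<^sup>2 * (1 + norm x) * (\<tau> * s * wt u)"
  proof (rule add_mono)
    have "2 * b\<^sup>2 * (1 + norm x) * (s\<^sup>2 * wt u) \<le> 2 * b\<^sup>2 * (1 + norm x) * (\<tau> * s * wt u)"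
      using s wt_ge_1[of u] by (intro mult_left_mono mult_right_mono) (auto simp: power2_eq_square)
    then show "norm (s\<^sup>2 *\<^sub>R \<mu> x + corr (s\<^sup>2) x u) \<le> 2 * b\<^sup>2 * (1 + norm x) * (\<tau> * s * wt u)"
      using drift_corr_bound[of x u] by linarith
    have "b * (1 + norm x) * (1 * s * wt u) \<le> b\<^sup>2 * (1 + norm x) * (\<tau> * s * wt u)"
      using s wt_ge_1[of u] constants_ge b_ge \<tau> by (intro mult_mono) auto
    then show "norm (drive x u) \<le> b\<^sup>2 * (1 + norm x) * (\<tau> * s * wt u)"
      using drive_bound_wt[of x u] by simp
  qed
  also have "\<dots> = \<beta> * (1 + norm x) * (s * wt u)"
    by (simp add: \<beta>_def algebra_simps)
  finally show ?thesis .
qed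

lemma one_plus_step_bound: "1 + norm (step (s\<^sup>2) x u) \<le> \<gamma> * (1 + norm x) * wt u"
proof -
  have "1 + norm (step (s\<^sup>2) x u) \<le> (1 + norm x) + norm (step (s\<^sup>2) x u - x)"
    using norm_triangle_ineq[of x "step (s\<^sup>2) x u - x"] by simp
  also have "\<dots> \<le> (1 + norm x) * wt u + \<beta> * (1 + norm x) * (\<tau> * wt u)"
  proof (rule add_mono)
    show "1 + norm x \<le> (1 + norm x) * wt u"
      using mult_left_mono[OF wt_ge_1[of u], of "1 + norm x"] by simp
    have "\<beta> * (1 + norm x) * (s * wt u) \<le> \<beta> * (1 + norm x) * (\<tau> * wt u)"
      using s wt_ge_1[of u] constants_ge by (intro mult_left_mono mult_right_mono) auto
    then show "norm (step (s\<^sup>2) x u - x) \<le> \<beta> * (1 + norm x) * (\<tau> * wt u)"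
      using step_diff_bound[of x u] by linarith
  qed
  also have "\<dots> = \<gamma> * (1 + norm x) * wt u"
    by (simp add: \<gamma>_def algebra_simps)
  finally show ?thesis .
qed

text \<open>The remainder does not involve \<open>v\<close>; the factor \<open>wt v\<close>, at
  least 1, is inserted so that drift and noise share one weight, as the moment estimates
  require.\<close>

lemma crude_drift_bound: "norm (crude_drift (s\<^sup>2) x u) \<le> \<kappa>1 * (1 + norm x) * s ^ 3 * (wt u * wt v)"
proof -
  define y where "y = step (s\<^sup>2) x u"
  have "norm (crude_drift (s\<^sup>2) x u) \<le> s\<^sup>2 * (b * norm (y - x))"
    using drift_lipschitz by (simp add: crude_drift_def y_def mult_left_mono)
  also have "\<dots> \<le> s\<^sup>2 * (b * (\<beta> * (1 + norm x) * (s * wt u)))"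
    using step_diff_bound[of x u] b_ge by (intro mult_left_mono) (auto simp: y_def)
  also have "\<dots> = (b * \<beta>) * (1 + norm x) * s ^ 3 * wt u"
    by (simp add: power2_eq_square power3_eq_cube)
  also have "\<dots> \<le> \<kappa>1 * (1 + norm x) * s ^ 3 * (wt u * wt v)"
    using s wt_ge_1[of u] wt_le_prod constants_ge b_ge
    by (intro mult_mono) (auto simp: \<kappa>1_def add_increasing2)
  finally show ?thesis .
qed

lemma crude_noise_bound: "norm (crude_noise (s\<^sup>2) x u v) \<le> \<kappa>1 * (1 + norm x) * s\<^sup>2 * (wt u * wt v)"
proof -
  define y where "y = step (s\<^sup>2) x u"
  have "norm (corr (s\<^sup>2) x u) \<le> b\<^sup>2 * (1 + norm x) * (s\<^sup>2 * (wt u * wt v))"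
    by (rule order_trans[OF corr_bound mult_left_mono])
       (use s wt_le_prod in \<open>auto intro: mult_left_mono\<close>)
  moreover have "norm (drive y v - drive x v) \<le> b * \<beta> * (1 + norm x) * (s\<^sup>2 * (wt u * wt v))"
  proof -
    have "norm (drive y v - drive x v) \<le> b * (\<beta> * (1 + norm x) * (s * wt u)) * (s * wt v)"
      by (rule order_trans[OF drive_lipschitz mult_mono])
         (use b_ge step_diff_bound[of x u] norm_le_wt constants_ge s wt_ge_1[of u] in
           \<open>auto simp: y_def intro: mult_left_mono\<close>)
    then show ?thesis by (simp add: power2_eq_square ac_simps)
  qed
  moreover have "norm (corr (s\<^sup>2) y v) \<le> b\<^sup>2 * \<gamma> * (1 + norm x) * (s\<^sup>2 * (wt u * wt v))"
  proof -
    have "norm (corr (s\<^sup>2) y v) \<le> b\<^sup>2 * (\<gamma> * (1 + norm x) * wt u) * (s\<^sup>2 * wt v)"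
      by (rule order_trans[OF corr_bound mult_right_mono])
         (use s b_ge one_plus_step_bound[of x u] wt_ge_1[of v] in
           \<open>auto simp: y_def intro: mult_left_mono\<close>)
    then show ?thesis by (simp add: ac_simps)
  qed
  moreover have "norm (crude_noise (s\<^sup>2) x u v)
      \<le> norm (corr (s\<^sup>2) x u) + norm (drive y v - drive x v) + norm (corr (s\<^sup>2) y v)"
    unfolding crude_noise_def y_def[symmetric] by norm
  ultimately show ?thesis
    by (simp add: \<kappa>1_def algebra_simps)
qed

text \<open>The displacement is the drive plus terms of size \<open>s\<^sup>2\<close>, so
  linearising along the drive alone costs the quadratic Taylor remainder and one derivative of those
  terms, both of order \<open>s\<^sup>2\<close>. The function is kept general because the bound
  serves the drift and each diffusion coefficient.\<close>

lemma taylor_drive_bound: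
  assumes "smooth_bounded K g D"
  shows "norm (g (step (s\<^sup>2) x u) - g x - blinfun_apply (D x) (drive x u))
      \<le> K * ((\<beta>\<^sup>2 + 2 * b\<^sup>2) * ((1 + norm x) * (s * wt u))\<^sup>2)"
proof -
  define y where "y = step (s\<^sup>2) x u"
  define X where "X = 1 + norm x"
  have X: "1 \<le> X" by (simp add: X_def)
  have "y - x = drive x u + (s\<^sup>2 *\<^sub>R \<mu> x + corr (s\<^sup>2) x u)"
    by (simp add: y_def step_def)
  then have "g y - g x - blinfun_apply (D x) (drive x u) = (g y - g x - blinfun_apply (D x) (y - x))
      + blinfun_apply (D x) (s\<^sup>2 *\<^sub>R \<mu> x + corr (s\<^sup>2) x u)"
    by (simp only: blinfun.add_right) simp
  then have "norm (g y - g x - blinfun_apply (D x) (drive x u))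
      \<le> norm (g y - g x - blinfun_apply (D x) (y - x)) + norm (blinfun_apply (D x) (s\<^sup>2 *\<^sub>R \<mu> x + corr (s\<^sup>2) x u))"
    by (simp only: norm_triangle_ineq)
  also have "\<dots> \<le> K * (norm (y - x))\<^sup>2 + K * norm (s\<^sup>2 *\<^sub>R \<mu> x + corr (s\<^sup>2) x u)"
    using assms by (intro add_mono smooth_bounded_taylor blinfun_apply_bound) (auto simp: smooth_bounded_def)
  also have "\<dots> \<le> K * (\<beta> * X * (s * wt u))\<^sup>2 + K * (2 * b\<^sup>2 * X * (s\<^sup>2 * wt u))"
    using K step_diff_bound[of x u] drift_corr_bound[of x u]
    by (intro add_mono mult_left_mono power_mono) (auto simp: y_def X_def)
  \<comment> \<open>Both \<open>X\<close> and the weight are at least 1, so the second term may be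
    raised to the squares that the Taylor remainder carries anyway.\<close>
  also have "\<dots> \<le> K * (\<beta> * X * (s * wt u))\<^sup>2 + K * (2 * b\<^sup>2 * X\<^sup>2 * (s\<^sup>2 * (wt u)\<^sup>2))"
    using K X wt_ge_1[of u]
    by (intro add_left_mono mult_left_mono mult_mono) (auto simp: power2_eq_square)
  also have "\<dots> = K * ((\<beta>\<^sup>2 + 2 * b\<^sup>2) * (X * (s * wt u))\<^sup>2)"
    by (simp add: power_mult_distrib algebra_simps)
  finally show ?thesis by (simp add: y_def X_def)
qed

lemma fine_drift_bound:
  "norm (fine_drift (s\<^sup>2) x u) \<le> \<kappa>2 * (1 + norm x)\<^sup>2 * s ^ 4 * (wt u * wt v)\<^sup>2"
proof -
  have "norm (fine_drift (s\<^sup>2) x u) \<le> s\<^sup>2 * (K * ((\<beta>\<^sup>2 + 2 * b\<^sup>2) * ((1 + norm x) * (s * wt u))\<^sup>2))"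
    using taylor_drive_bound[OF \<mu>] by (simp add: fine_drift_def mult_left_mono)
  also have "\<dots> = (K * (\<beta>\<^sup>2 + 2 * b\<^sup>2)) * (1 + norm x)\<^sup>2 * s ^ 4 * (wt u)\<^sup>2"
    by (simp add: power_mult_distrib power2_eq_square eval_nat_numeral)
  also have "\<dots> \<le> \<kappa>2 * (1 + norm x)\<^sup>2 * s ^ 4 * (wt u * wt v)\<^sup>2"
  proof (intro mult_mono)
    have "K * (\<beta>\<^sup>2 + 2 * b\<^sup>2) \<le> b * (\<beta>\<^sup>2 + 2 * b\<^sup>2)"
      using b_ge by (intro mult_right_mono) auto
    then show "K * (\<beta>\<^sup>2 + 2 * b\<^sup>2) \<le> \<kappa>2"
      using constants_ge by (simp add: \<kappa>2_def add_increasing2)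
  qed (use s wt_le_prod wt_ge_1[of u] constants_ge in \<open>auto intro: power_mono\<close>)
  finally show ?thesis .
qed

text \<open>Each of the three terms has order \<open>s ^ 3\<close>: a second order Taylor remainder
  times an increment, the change of the correction over a displacement of size \<open>s\<close>, and
  \<open>s\<^sup>2\<close> times a drive.\<close>

lemma fine_noise_bound:
  "norm (fine_noise (s\<^sup>2) x u v) \<le> \<kappa>2 * (1 + norm x)\<^sup>2 * s ^ 3 * (wt u * wt v)\<^sup>2"
proof -
  define y where "y = step (s\<^sup>2) x u"
  define X where "X = 1 + norm x"
  define R where "R = wt u * wt v"
  have X: "1 \<le> X" by (simp add: X_def)
  then have X2: "X \<le> X\<^sup>2" by (intro self_le_power) auto
  have R: "1 \<le> R" "R \<le> R\<^sup>2" "wt u \<le> R"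
    using wt_le_prod by (auto simp: R_def)
  have "norm (\<Sum>j\<in>UNIV. (v $ j) *\<^sub>R (\<sigma> j y - \<sigma> j x - blinfun_apply (D\<sigma> j x) (drive x u)))
      \<le> (b * (\<beta>\<^sup>2 + 2 * b\<^sup>2)) * (X\<^sup>2 * s ^ 3 * R\<^sup>2)"
  proof -
    have "norm (\<Sum>j\<in>UNIV. (v $ j) *\<^sub>R (\<sigma> j y - \<sigma> j x - blinfun_apply (D\<sigma> j x) (drive x u)))
        \<le> real CARD('m) * (norm v * (K * ((\<beta>\<^sup>2 + 2 * b\<^sup>2) * (X * (s * wt u))\<^sup>2)))"
      unfolding y_def X_def by (intro norm_sum_components_le taylor_drive_bound \<sigma>)
    also have "\<dots> = (b * (\<beta>\<^sup>2 + 2 * b\<^sup>2)) * (X\<^sup>2 * (s\<^sup>2 * (wt u)\<^sup>2 * norm v))"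
      by (simp add: b_def power_mult_distrib)
    also have "\<dots> \<le> (b * (\<beta>\<^sup>2 + 2 * b\<^sup>2)) * (X\<^sup>2 * (s\<^sup>2 * (wt u)\<^sup>2 * (s * (wt v)\<^sup>2)))"
    proof (intro mult_left_mono)
      have "s * wt v \<le> s * (wt v)\<^sup>2"
        using s wt_ge_1[of v] by (intro mult_left_mono self_le_power) auto
      then show "norm v \<le> s * (wt v)\<^sup>2"
        using norm_le_wt[of v] by linarith
    qed (use b_ge in auto)
    also have "\<dots> = (b * (\<beta>\<^sup>2 + 2 * b\<^sup>2)) * (X\<^sup>2 * s ^ 3 * R\<^sup>2)"
      by (simp add: R_def power_mult_distrib power2_eq_square power3_eq_cube)
    finally show ?thesis .
  qed
  moreover have "norm (corr (s\<^sup>2) y v - corr (s\<^sup>2) x v) \<le> (2 * b\<^sup>2 * \<beta>) * (X\<^sup>2 * s ^ 3 * R\<^sup>2)"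
  proof -
    have "norm (corr (s\<^sup>2) y v - corr (s\<^sup>2) x v) \<le> 2 * b\<^sup>2 * X * norm (y - x) * (s\<^sup>2 * wt v)"
      using corr_lipschitz[of "s\<^sup>2" x v y] s by (simp add: norm_minus_commute X_def)
    also have "\<dots> \<le> 2 * b\<^sup>2 * X * (\<beta> * X * (s * wt u)) * (s\<^sup>2 * wt v)"
      using step_diff_bound[of x u] wt_ge_1[of v] X
      by (intro mult_left_mono mult_right_mono) (auto simp: y_def X_def)
    also have "\<dots> = (2 * b\<^sup>2 * \<beta>) * (X\<^sup>2 * s ^ 3 * R)"
      by (simp add: R_def power2_eq_square power3_eq_cube)
    also have "\<dots> \<le> (2 * b\<^sup>2 * \<beta>) * (X\<^sup>2 * s ^ 3 * R\<^sup>2)"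
      using R s constants_ge by (intro mult_left_mono) auto
    finally show ?thesis .
  qed
  moreover have "norm (s\<^sup>2 *\<^sub>R blinfun_apply (D\<mu> x) (drive x u)) \<le> b\<^sup>2 * (X\<^sup>2 * s ^ 3 * R\<^sup>2)"
  proof -
    have "norm (s\<^sup>2 *\<^sub>R blinfun_apply (D\<mu> x) (drive x u)) \<le> s\<^sup>2 * (K * norm (drive x u))"
      using D\<mu>_bound by (simp add: mult_left_mono)
    also have "\<dots> \<le> s\<^sup>2 * (b * (b * X * (s * wt u)))"
      using drive_bound_wt[of x u] b_ge K by (intro mult_left_mono mult_mono) (auto simp: X_def)
    also have "\<dots> = b\<^sup>2 * (X * s ^ 3 * wt u)"
      by (simp add: power2_eq_square power3_eq_cube)
    also have "\<dots> \<le> b\<^sup>2 * (X\<^sup>2 * s ^ 3 * R\<^sup>2)"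
      using X X2 R s wt_ge_1[of u] by (intro mult_left_mono mult_mono) auto
    finally show ?thesis .
  qed
  ultimately have "norm (fine_noise (s\<^sup>2) x u v) \<le> (b * (\<beta>\<^sup>2 + 2 * b\<^sup>2)) * (X\<^sup>2 * s ^ 3 * R\<^sup>2)
      + (2 * b\<^sup>2 * \<beta>) * (X\<^sup>2 * s ^ 3 * R\<^sup>2) + b\<^sup>2 * (X\<^sup>2 * s ^ 3 * R\<^sup>2)"
    unfolding fine_noise_def y_def[symmetric] by (intro norm_triangle_le add_mono)
  also have "\<dots> = \<kappa>2 * X\<^sup>2 * s ^ 3 * R\<^sup>2"
    by (simp add: \<kappa>2_def algebra_simps)
  finally show ?thesis by (simp add: X_def R_def)
qed

end

end

subsection \<open>One step of the coupled schemes\<close>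

lemma power4_add_le: "(x + y) ^ 4 \<le> 8 * (x ^ 4 + y ^ 4)" for x y :: real
proof -
  have "8 * (x ^ 4 + y ^ 4) - (x + y) ^ 4 = (x - y)\<^sup>2 * (2 * x\<^sup>2 + 2 * y\<^sup>2 + 5 * (x + y)\<^sup>2)"
    by (simp add: eval_nat_numeral algebra_simps)
  also have "\<dots> \<ge> 0" by simp
  finally show ?thesis by simp
qed

text \<open>The term linear in \<open>r\<close> is kept exactly, since centring can act on it alone.
  The other mixed terms are bounded by Cauchy-Schwarz, the cubic one after splitting it into its
  quadratic and quartic neighbours.\<close>

lemma norm_add_power4_le:
  fixes x r :: "'a::real_inner"
  shows "norm (x + r) ^ 4 \<le> norm x ^ 4 + 4 * (norm x)\<^sup>2 * (x \<bullet> r)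
      + 8 * (norm x)\<^sup>2 * (norm r)\<^sup>2 + 3 * norm r ^ 4"
proof -
  define a c i where "a = norm x" and "c = norm r" and "i = x \<bullet> r"
  have i: "\<bar>i\<bar> \<le> a * c"
    unfolding a_def c_def i_def by (rule Cauchy_Schwarz_ineq2)
  have nonneg: "0 \<le> a" "0 \<le> c" by (auto simp: a_def c_def)
  have "(norm (x + r))\<^sup>2 = a\<^sup>2 + 2 * i + c\<^sup>2"
    by (simp add: a_def c_def i_def power2_norm_eq_inner inner_add inner_commute)
  then have "norm (x + r) ^ 4 = (a\<^sup>2 + 2 * i + c\<^sup>2)\<^sup>2"
    by (metis (no_types) mult_2 numeral_Bit0 power2_eq_square power_add)
  also have "\<dots> = a ^ 4 + 4 * a\<^sup>2 * i + 2 * a\<^sup>2 * c\<^sup>2 + 4 * i\<^sup>2 + 4 * (i * c\<^sup>2) + c ^ 4"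
    by (simp add: eval_nat_numeral algebra_simps)
  also have "\<dots> \<le> a ^ 4 + 4 * a\<^sup>2 * i + 2 * a\<^sup>2 * c\<^sup>2 + 4 * (a\<^sup>2 * c\<^sup>2)
      + 2 * (a\<^sup>2 * c\<^sup>2 + c ^ 4) + c ^ 4"
  proof -
    have "i\<^sup>2 \<le> a\<^sup>2 * c\<^sup>2"
      using power_mono[OF i abs_ge_zero, of 2] by (simp add: power_mult_distrib)
    moreover have "i * c\<^sup>2 \<le> (a * c) * c\<^sup>2"
      using i by (intro mult_right_mono) auto
    moreover have "2 * ((a * c) * c\<^sup>2) \<le> a\<^sup>2 * c\<^sup>2 + c ^ 4"
      using zero_le_power2[of "a * c - c\<^sup>2"] by (simp add: power2_diff power_mult_distrib flip: power_mult)
    ultimately have "4 * (i * c\<^sup>2) \<le> 2 * (a\<^sup>2 * c\<^sup>2 + c ^ 4)" "4 * i\<^sup>2 \<le> 4 * (a\<^sup>2 * c\<^sup>2)"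
      by (auto simp del: power_mult_distrib)
    then show ?thesis by (intro add_mono order_refl)
  qed
  finally show ?thesis
    by (simp add: a_def c_def i_def algebra_simps)
qed

section \<open>Moments of a vector moved by a small drift and a centred noise\<close>

context
  fixes \<nu> :: "'w pmf" and P Q :: "'w \<Rightarrow> 'a::euclidean_space" and D :: 'a
    and R :: "'w \<Rightarrow> real" and c s Y \<tau> :: real
  assumes fin: "finite (set_pmf \<nu>)"
    and centered: "measure_pmf.expectation \<nu> Q = 0"
    and D: "norm D \<le> Y" and s: "0 < s" "s \<le> \<tau>" and c: "0 \<le> c"
    and P: "\<And>w. norm (P w) \<le> c * s\<^sup>2 * Y * R w"
    and Q: "\<And>w. norm (Q w) \<le> c * s * Y * R w"
    and R: "\<And>w. 1 \<le> R w"
begin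

private lemma Y: "0 \<le> Y"
  using order_trans[OF norm_ge_zero D] .

private lemma integrable: "integrable \<nu> f" for f :: "'w \<Rightarrow> 'b::{banach, second_countable_topology}"
  using fin by (rule integrable_measure_pmf_finite)

private lemma PQ: "norm (P w + Q w) \<le> (c * (\<tau> + 1)) * s * Y * R w"
proof -
  have "norm (P w + Q w) \<le> c * s\<^sup>2 * Y * R w + c * s * Y * R w"
    by (intro norm_triangle_le add_mono P Q)
  also have "\<dots> = (c * (s + 1)) * s * Y * R w"
    by (simp add: power2_eq_square algebra_simps)
  also have "\<dots> \<le> (c * (\<tau> + 1)) * s * Y * R w"
    using Y c s R[of w] by (intro mult_right_mono mult_left_mono) auto
  finally show ?thesis .
qed

private lemma inner_centered: "measure_pmf.expectation \<nu> (\<lambda>w. D \<bullet> Q w) = 0"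
  using integral_inner_right[of D \<nu> Q, OF integrable] centered by simp

text \<open>Here \<open>s\<close> is the square root of the step size.\<close>

lemma expectation_perturbed_power4:
  assumes "measure_pmf.expectation \<nu> (\<lambda>w. R w ^ 4) \<le> \<kappa>"
  shows "measure_pmf.expectation \<nu> (\<lambda>w. norm (D + P w + Q w) ^ 4)
     \<le> norm D ^ 4 + (4 * c + 8 * (c * (\<tau> + 1))\<^sup>2 + 3 * (c * (\<tau> + 1)) ^ 4 * \<tau>\<^sup>2) * \<kappa> * s\<^sup>2 * Y ^ 4"
proof -
  define m where "m = c * (\<tau> + 1)"
  define M where "M = 4 * c + 8 * m\<^sup>2 + 3 * m ^ 4 * \<tau>\<^sup>2"
  have m: "0 \<le> m" using c s by (simp add: m_def)
  have "norm (D + P w + Q w) ^ 4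
      \<le> norm D ^ 4 + 4 * (norm D)\<^sup>2 * (D \<bullet> Q w) + M * s\<^sup>2 * Y ^ 4 * R w ^ 4" for w
  proof -
    define r where "r = P w + Q w"
    have r: "norm r \<le> m * s * Y * R w"
      using PQ[of w] by (simp add: r_def m_def)
    have pow: "R w \<le> R w ^ 4" "(R w)\<^sup>2 \<le> R w ^ 4" "1 \<le> R w ^ 4"
      using R[of w] by (auto intro: self_le_power power_increasing)
    have 1: "(norm D)\<^sup>2 * (D \<bullet> P w) \<le> c * s\<^sup>2 * Y ^ 4 * R w ^ 4"
    proof -
      have "D \<bullet> P w \<le> norm D * norm (P w)"
        by (rule norm_cauchy_schwarz)
      then have "(norm D)\<^sup>2 * (D \<bullet> P w) \<le> (norm D)\<^sup>2 * (norm D * norm (P w))"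
        by (intro mult_left_mono) auto
      also have "\<dots> \<le> Y\<^sup>2 * (Y * (c * s\<^sup>2 * Y * R w ^ 4))"
        using D Y P[of w] pow c
        by (intro mult_mono power_mono order_trans[OF P mult_left_mono]) auto
      finally show ?thesis by (simp add: eval_nat_numeral ac_simps)
    qed
    have 2: "(norm D)\<^sup>2 * (norm r)\<^sup>2 \<le> m\<^sup>2 * s\<^sup>2 * Y ^ 4 * R w ^ 4"
    proof -
      have "(norm D)\<^sup>2 * (norm r)\<^sup>2 \<le> Y\<^sup>2 * (m * s * Y * R w)\<^sup>2"
        using D r by (intro mult_mono power_mono) auto
      also have "\<dots> = m\<^sup>2 * s\<^sup>2 * Y ^ 4 * (R w)\<^sup>2"
        by (simp add: eval_nat_numeral ac_simps)
      also have "\<dots> \<le> m\<^sup>2 * s\<^sup>2 * Y ^ 4 * R w ^ 4"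
        using pow by (intro mult_left_mono) auto
      finally show ?thesis .
    qed
    \<comment> \<open>This term is of order \<open>s ^ 4\<close>; two of the powers are given up for
      \<open>\<tau>\<^sup>2\<close> so that all error terms share the factor
      \<open>s\<^sup>2\<close>.\<close>
    have 3: "norm r ^ 4 \<le> m ^ 4 * \<tau>\<^sup>2 * s\<^sup>2 * Y ^ 4 * R w ^ 4"
    proof -
      have "norm r ^ 4 \<le> (m * s * Y * R w) ^ 4"
        using r by (intro power_mono) auto
      also have "\<dots> = m ^ 4 * s\<^sup>2 * s\<^sup>2 * Y ^ 4 * R w ^ 4"
        by (simp add: eval_nat_numeral ac_simps)
      also have "\<dots> \<le> m ^ 4 * \<tau>\<^sup>2 * s\<^sup>2 * Y ^ 4 * R w ^ 4"
        using s pow by (intro mult_right_mono mult_left_mono power_mono) auto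
      finally show ?thesis .
    qed
    have "norm (D + r) ^ 4 \<le> norm D ^ 4 + 4 * (norm D)\<^sup>2 * (D \<bullet> r)
        + 8 * (norm D)\<^sup>2 * (norm r)\<^sup>2 + 3 * norm r ^ 4"
      by (rule norm_add_power4_le)
    also have "4 * (norm D)\<^sup>2 * (D \<bullet> r) = 4 * ((norm D)\<^sup>2 * (D \<bullet> P w)) + 4 * (norm D)\<^sup>2 * (D \<bullet> Q w)"
      by (simp add: r_def inner_add_right algebra_simps)
    finally show ?thesis
      using 1 2 3 by (simp add: r_def M_def algebra_simps)
  qed
  then have "measure_pmf.expectation \<nu> (\<lambda>w. norm (D + P w + Q w) ^ 4)
      \<le> measure_pmf.expectation \<nu>
          (\<lambda>w. norm D ^ 4 + 4 * (norm D)\<^sup>2 * (D \<bullet> Q w) + M * s\<^sup>2 * Y ^ 4 * R w ^ 4)"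
    by (rule expectation_mono_finite[OF fin])
  also have "\<dots> = norm D ^ 4 + M * s\<^sup>2 * Y ^ 4 * measure_pmf.expectation \<nu> (\<lambda>w. R w ^ 4)"
    by (simp add: integrable inner_centered del: inner_commute)
  also have "\<dots> \<le> norm D ^ 4 + M * s\<^sup>2 * Y ^ 4 * \<kappa>"
    using assms c m Y by (intro add_left_mono mult_left_mono) (auto simp: M_def)
  finally show ?thesis by (simp add: M_def m_def ac_simps)
qed

text \<open>The weight enters only through its square, so \<open>R\<close> may itself be the square
  of a product of increment weights. This room pays for the squared weights in the fine
  remainders.\<close>

lemma expectation_perturbed_power2:
  assumes "measure_pmf.expectation \<nu> (\<lambda>w. (R w)\<^sup>2) \<le> \<kappa>"
  shows "measure_pmf.expectation \<nu> (\<lambda>w. (norm (D + P w + Q w))\<^sup>2)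
     \<le> (norm D)\<^sup>2 + (2 * c + (c * (\<tau> + 1))\<^sup>2) * \<kappa> * s\<^sup>2 * Y\<^sup>2"
proof -
  define m where "m = c * (\<tau> + 1)"
  define M where "M = 2 * c + m\<^sup>2"
  have "(norm (D + P w + Q w))\<^sup>2 \<le> (norm D)\<^sup>2 + 2 * (D \<bullet> Q w) + M * s\<^sup>2 * Y\<^sup>2 * (R w)\<^sup>2" for w
  proof -
    define r where "r = P w + Q w"
    have pow: "R w \<le> (R w)\<^sup>2"
      using R[of w] by (intro self_le_power) auto
    have "D \<bullet> P w \<le> norm D * norm (P w)"
      by (rule norm_cauchy_schwarz)
    also have "\<dots> \<le> Y * (c * s\<^sup>2 * Y * (R w)\<^sup>2)"
      using D Y P[of w] pow c by (intro mult_mono order_trans[OF P mult_left_mono]) auto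
    finally have 1: "D \<bullet> P w \<le> c * s\<^sup>2 * Y\<^sup>2 * (R w)\<^sup>2"
      by (simp add: power2_eq_square ac_simps)
    have "(norm r)\<^sup>2 \<le> (m * s * Y * R w)\<^sup>2"
      using PQ[of w] by (intro power_mono) (auto simp: r_def m_def)
    then have 2: "(norm r)\<^sup>2 \<le> m\<^sup>2 * s\<^sup>2 * Y\<^sup>2 * (R w)\<^sup>2"
      by (simp add: power_mult_distrib)
    have "(norm (D + r))\<^sup>2 = (norm D)\<^sup>2 + 2 * (D \<bullet> P w) + 2 * (D \<bullet> Q w) + (norm r)\<^sup>2"
      by (simp add: r_def power2_norm_eq_inner inner_add inner_commute algebra_simps)
    then show ?thesis
      using 1 2 by (simp add: r_def M_def algebra_simps)
  qed
  then have "measure_pmf.expectation \<nu> (\<lambda>w. (norm (D + P w + Q w))\<^sup>2)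
      \<le> measure_pmf.expectation \<nu> (\<lambda>w. (norm D)\<^sup>2 + 2 * (D \<bullet> Q w) + M * s\<^sup>2 * Y\<^sup>2 * (R w)\<^sup>2)"
    by (rule expectation_mono_finite[OF fin])
  also have "\<dots> = (norm D)\<^sup>2 + M * s\<^sup>2 * Y\<^sup>2 * measure_pmf.expectation \<nu> (\<lambda>w. (R w)\<^sup>2)"
    by (simp add: integrable inner_centered del: inner_commute)
  also have "\<dots> \<le> (norm D)\<^sup>2 + M * s\<^sup>2 * Y\<^sup>2 * \<kappa>"
    using assms c by (intro add_left_mono mult_left_mono) (auto simp: M_def)
  finally show ?thesis by (simp add: M_def m_def ac_simps)
qed

end

section \<open>Centred functions of two independent increments\<close>

definition centered :: "'u pmf \<Rightarrow> 'v pmf \<Rightarrow> ('u \<Rightarrow> 'v \<Rightarrow> 'a::euclidean_space) \<Rightarrow> bool" where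
  "centered p q g \<longleftrightarrow> measure_pmf.expectation (pair_pmf p q) (\<lambda>z. g (fst z) (snd z)) = 0"

context
  fixes p q :: "(real^'m::finite) pmf" and \<kappa> h :: real
  assumes p: "increment_law \<kappa> h p" and q: "increment_law \<kappa> h q"
begin

lemma finite_set_pair: "finite (set_pmf (pair_pmf p q))"
  using p q by (simp add: increment_law_def)

lemma integrable_increment:
  "integrable p f" "integrable q f" "integrable (pair_pmf p q) f'"
  for f :: "real^'m \<Rightarrow> 'b::euclidean_space" and f' :: "(real^'m) \<times> (real^'m) \<Rightarrow> 'b"
  using p q by (auto intro!: integrable_measure_pmf_finite simp: increment_law_def)

lemma centered_add: "centered p q f \<Longrightarrow> centered p q g \<Longrightarrow> centered p q (\<lambda>u v. f u v + g u v)"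
  by (simp add: centered_def integrable_increment)

lemma centered_diff: "centered p q f \<Longrightarrow> centered p q g \<Longrightarrow> centered p q (\<lambda>u v. f u v - g u v)"
  by (simp add: centered_def integrable_increment)

lemma centered_scaleR: "centered p q f \<Longrightarrow> centered p q (\<lambda>u v. a *\<^sub>R f u v)"
  by (simp add: centered_def integrable_increment)

lemma centered_swap: "centered q p (\<lambda>v u. f u v) \<Longrightarrow> centered p q f"
  unfolding centered_def by (subst pair_commute_pmf) (simp add: case_prod_beta)

text \<open>The coefficients may depend on the other increment: by independence the integral over
  \<open>u\<close> is taken with \<open>v\<close> frozen and vanishes. With the roles exchanged this
  covers the second step, whose starting point depends on the first increment.\<close>

lemma centered_linear_fst: "centered p q (\<lambda>u v. \<Sum>j\<in>UNIV. (u $ j) *\<^sub>R a j v)"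
  using p q unfolding centered_def
  by (subst integral_pair_pmf_finite_swap) (auto simp: increment_law_def integrable_increment)

lemma centered_quadratic_fst:
  "centered p q (\<lambda>u v. \<Sum>j\<in>UNIV. \<Sum>k\<in>UNIV. (u $ j * u $ k - (if j = k then h else 0)) *\<^sub>R a j k v)"
  using p q unfolding centered_def
  by (subst integral_pair_pmf_finite_swap)
     (auto simp: increment_law_def integrable_increment simp del: integral_indicator)

lemma expectation_weight_product:
  assumes "h > 0"
  shows "measure_pmf.expectation (pair_pmf p q)
      (\<lambda>z. (increment_weight h (fst z) * increment_weight h (snd z)) ^ 4) \<le> \<kappa>\<^sup>2"
proof -
  have "measure_pmf.expectation (pair_pmf p q)
      (\<lambda>z. (increment_weight h (fst z) * increment_weight h (snd z)) ^ 4)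
    = measure_pmf.expectation p (\<lambda>u. increment_weight h u ^ 4)
      * measure_pmf.expectation q (\<lambda>v. increment_weight h v ^ 4)"
    using p q by (subst integral_pair_pmf_finite) (auto simp: increment_law_def power_mult_distrib integrable_increment)
  also have "\<dots> \<le> \<kappa> * \<kappa>"
  proof (rule mult_mono)
    have nonneg: "0 \<le> measure_pmf.expectation r (\<lambda>v. increment_weight h v ^ 4)" for r :: "(real^'m) pmf"
      by (rule Bochner_Integration.integral_nonneg) simp
    then show "0 \<le> measure_pmf.expectation q (\<lambda>v. increment_weight h v ^ 4)" .
    show "0 \<le> \<kappa>"
      using order_trans[OF nonneg] p by (auto simp: increment_law_def)
  qed (use p q in \<open>auto simp: increment_law_def\<close>)
  finally show ?thesis by (simp add: power2_eq_square)
qed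

end

definition lyapunov :: "real \<Rightarrow> 'a::euclidean_space \<Rightarrow> 'a \<Rightarrow> 'a \<Rightarrow> real" where
  "lyapunov s x y w = (norm ((1/2) *\<^sub>R (x + y) - w))\<^sup>2 + norm (x - w) ^ 4 + norm (y - w) ^ 4
     + s ^ 4 * (1 + norm x ^ 4 + norm y ^ 4 + norm w ^ 4)"

text \<open>The sources \<open>Y\<close> of the one-step estimates, raised to the fourth or second
  power, are dominated by the Lyapunov function. The constants arise as 64 = 8 * 8 from two uses of
  \<open>power4_add_le\<close>, 520 = 8 * (1 + 64) and 260 = 4 * (1 + 64).\<close>

lemma lyapunov_bounds:
  fixes x y w :: "'a::euclidean_space" and s :: real
  defines "X \<equiv> 1 + norm x + norm y + norm w"
  shows "0 \<le> lyapunov s x y w"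
    "s ^ 4 * X ^ 4 \<le> 64 * lyapunov s x y w"
    "(norm (x - w) + s * X) ^ 4 \<le> 520 * lyapunov s x y w"
    "(norm (y - w) + s * X) ^ 4 \<le> 520 * lyapunov s x y w"
    "(norm ((1/2) *\<^sub>R (x + y) - w) + (norm (x - w))\<^sup>2 + (norm (y - w))\<^sup>2 + s\<^sup>2 * (X)\<^sup>2)\<^sup>2
      \<le> 260 * lyapunov s x y w"
proof -
  define e \<delta> \<delta>' Z where "e = (norm ((1/2) *\<^sub>R (x + y) - w))\<^sup>2" and "\<delta> = norm (x - w) ^ 4"
    and "\<delta>' = norm (y - w) ^ 4" and "Z = s ^ 4 * (1 + norm x ^ 4 + norm y ^ 4 + norm w ^ 4)"
  have V: "lyapunov s x y w = e + \<delta> + \<delta>' + Z"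
    by (simp add: lyapunov_def e_def \<delta>_def \<delta>'_def Z_def)
  have nonneg: "0 \<le> e" "0 \<le> \<delta>" "0 \<le> \<delta>'" "0 \<le> Z"
    by (simp_all add: e_def \<delta>_def \<delta>'_def Z_def)
  then show 0: "0 \<le> lyapunov s x y w" by (simp add: V)
  have "X ^ 4 \<le> 8 * ((1 + norm x) ^ 4 + (norm y + norm w) ^ 4)"
    using power4_add_le[of "1 + norm x" "norm y + norm w"] by (simp add: X_def add.assoc)
  also have "\<dots> \<le> 8 * (8 * (1 ^ 4 + norm x ^ 4) + 8 * (norm y ^ 4 + norm w ^ 4))"
    by (intro mult_left_mono add_mono power4_add_le) auto
  finally have "s ^ 4 * X ^ 4 \<le> s ^ 4 * (64 * (1 + norm x ^ 4 + norm y ^ 4 + norm w ^ 4))"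
    by (intro mult_left_mono) auto
  then have XZ: "s ^ 4 * X ^ 4 \<le> 64 * Z"
    by (simp add: Z_def ac_simps)
  then show "s ^ 4 * X ^ 4 \<le> 64 * lyapunov s x y w"
    using nonneg unfolding V by argo
  have "(norm (x - w) + s * X) ^ 4 \<le> 8 * (\<delta> + s ^ 4 * X ^ 4)"
    "(norm (y - w) + s * X) ^ 4 \<le> 8 * (\<delta>' + s ^ 4 * X ^ 4)"
    using power4_add_le[of "norm (x - w)" "s * X"] power4_add_le[of "norm (y - w)" "s * X"]
    by (simp_all add: \<delta>_def \<delta>'_def power_mult_distrib)
  then show "(norm (x - w) + s * X) ^ 4 \<le> 520 * lyapunov s x y w"
    "(norm (y - w) + s * X) ^ 4 \<le> 520 * lyapunov s x y w"
    using XZ nonneg unfolding V by argo+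
  have sq: "(a + b + c + d)\<^sup>2 \<le> 4 * (a\<^sup>2 + b\<^sup>2 + c\<^sup>2 + d\<^sup>2)" for a b c d :: real
  proof -
    have "4 * (a\<^sup>2 + b\<^sup>2 + c\<^sup>2 + d\<^sup>2) - (a + b + c + d)\<^sup>2
        = (a - b)\<^sup>2 + (a - c)\<^sup>2 + (a - d)\<^sup>2 + (b - c)\<^sup>2 + (b - d)\<^sup>2 + (c - d)\<^sup>2"
      by (simp add: power2_eq_square algebra_simps)
    also have "\<dots> \<ge> 0" by simp
    finally show ?thesis by simp
  qed
  have "(norm ((1/2) *\<^sub>R (x + y) - w) + (norm (x - w))\<^sup>2 + (norm (y - w))\<^sup>2 + s\<^sup>2 * (X)\<^sup>2)\<^sup>2
      \<le> 4 * (e + \<delta> + \<delta>' + s ^ 4 * X ^ 4)"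
    by (rule order_trans[OF sq]) (simp add: e_def \<delta>_def \<delta>'_def power_mult_distrib flip: power_mult)
  then show "(norm ((1/2) *\<^sub>R (x + y) - w) + (norm (x - w))\<^sup>2 + (norm (y - w))\<^sup>2 + s\<^sup>2 * (X)\<^sup>2)\<^sup>2
      \<le> 260 * lyapunov s x y w"
    using XZ nonneg unfolding V by argo
qed

context milstein_coefficients
begin

text \<open>Passing through the midpoint of \<open>x\<close> and \<open>y\<close>, the curvature of
  \<open>g\<close> costs only squares of the single errors, and the error of the average is the only
  linear term. Drift, diffusion and payoff all use this bound.\<close>

lemma smooth_average_bound:
  assumes "smooth_bounded K g D"
  shows "norm ((1/2) *\<^sub>R (g x + g y) - g z)
      \<le> K * (norm ((1/2) *\<^sub>R (x + y) - z) + 2 * ((norm (x - z))\<^sup>2 + (norm (y - z))\<^sup>2))"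
proof -
  define m where "m = (1/2) *\<^sub>R (x + y)"
  have "(norm (x - y))\<^sup>2 \<le> (norm (x - z) + norm (y - z))\<^sup>2"
    by (intro power_mono norm_diff_triangle_le[of x z _ y]) (auto simp: norm_minus_commute)
  also have "\<dots> \<le> 2 * ((norm (x - z))\<^sup>2 + (norm (y - z))\<^sup>2)"
    using zero_le_power2[of "norm (x - z) - norm (y - z)"] by (simp add: power2_sum power2_diff)
  finally have *: "(norm (x - y))\<^sup>2 \<le> 2 * ((norm (x - z))\<^sup>2 + (norm (y - z))\<^sup>2)" .
  have "(1/2) *\<^sub>R (g x + g y) - g z = ((1/2) *\<^sub>R (g x + g y) - g m) + (g m - g z)"
    by simp
  also have "norm \<dots> \<le> K * (norm (x - y))\<^sup>2 + K * norm (m - z)"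
    unfolding m_def
    by (intro norm_triangle_le add_mono smooth_bounded_midpoint[OF assms] smooth_bounded_lipschitz[OF assms])
  also have "\<dots> \<le> K * (2 * ((norm (x - z))\<^sup>2 + (norm (y - z))\<^sup>2)) + K * norm (m - z)"
    using * K by (intro add_right_mono mult_left_mono) auto
  finally show ?thesis by (simp add: m_def algebra_simps)
qed

definition two_step :: "real \<Rightarrow> real^'d \<Rightarrow> real^'m \<Rightarrow> real^'m \<Rightarrow> real^'d" where
  "two_step h x u v = step h (step h x u) v"

section \<open>Centring of the noise terms\<close>

context
  fixes p q :: "(real^'m) pmf" and \<kappa> h :: real
  assumes p: "increment_law \<kappa> h p" and q: "increment_law \<kappa> h q"
begin

lemma centered_drive:
  "centered p q (\<lambda>u v. drive (y v) u)" "centered p q (\<lambda>u v. drive (y' u) v)"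
proof -
  show "centered p q (\<lambda>u v. drive (y v) u)"
    unfolding drive_def by (rule centered_linear_fst[OF p q])
  show "centered p q (\<lambda>u v. drive (y' u) v)"
    unfolding drive_def by (rule centered_swap[OF p q centered_linear_fst[OF q p]])
qed

lemma centered_corr:
  "centered p q (\<lambda>u v. corr h (y v) u)" "centered p q (\<lambda>u v. corr h (y' u) v)"
proof -
  show "centered p q (\<lambda>u v. corr h (y v) u)"
    unfolding corr_def by (rule centered_scaleR[OF p q centered_quadratic_fst[OF p q]])
  have "centered q p (\<lambda>v u. corr h (y' u) v)"
    unfolding corr_def by (rule centered_scaleR[OF q p centered_quadratic_fst[OF q p]])
  then show "centered p q (\<lambda>u v. corr h (y' u) v)"
    by (rule centered_swap[OF p q])
qed

lemma cross_eq: "cross x u v = (\<Sum>j\<in>UNIV. (u $ j) *\<^sub>R (\<Sum>k\<in>UNIV. (v $ k) *\<^sub>R G j k x))"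
  by (simp add: cross_def scaleR_sum_right)

lemma centered_cross: "centered p q (\<lambda>u v. cross x u v)" "centered p q (\<lambda>u v. cross x v u)"
proof -
  show "centered p q (\<lambda>u v. cross x u v)"
    unfolding cross_eq by (rule centered_linear_fst[OF p q])
  show "centered p q (\<lambda>u v. cross x v u)"
    unfolding cross_eq by (rule centered_swap[OF p q centered_linear_fst[OF q p]])
qed

lemma centered_levy: "centered p q (\<lambda>u v. levy x u v)"
  unfolding levy_def by (intro centered_scaleR[OF p q] centered_diff[OF p q] centered_cross)

lemma centered_drive_double: "centered p q (\<lambda>u v. drive x (u + v))"
  unfolding drive_add by (intro centered_add[OF p q] centered_drive)

lemma centered_corr_double: "centered p q (\<lambda>u v. corr (2 * h) x (u + v))"
  unfolding corr_add
  by (intro centered_add[OF p q] centered_scaleR[OF p q] centered_corr centered_cross)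

lemma centered_crude_noise: "centered p q (\<lambda>u v. crude_noise h x u v)"
  unfolding crude_noise_def
  by (intro centered_add[OF p q] centered_diff[OF p q] centered_corr centered_drive)

lemma centered_fine_noise: "centered p q (\<lambda>u v. fine_noise h x u v)"
proof -
  have "blinfun_apply (D\<mu> x) (drive x u) = (\<Sum>j\<in>UNIV. (u $ j) *\<^sub>R blinfun_apply (D\<mu> x) (\<sigma> j x))" for u
    by (simp add: drive_def blinfun.sum_right blinfun.scaleR_right)
  then have "centered p q (\<lambda>u v. blinfun_apply (D\<mu> x) (drive x u))"
    by (simp add: centered_linear_fst[OF p q])
  moreover have "centered p q (\<lambda>u v. \<Sum>j\<in>UNIV. (v $ j) *\<^sub>R
      (\<sigma> j (step h x u) - \<sigma> j x - blinfun_apply (D\<sigma> j x) (drive x u)))"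
    by (rule centered_swap[OF p q centered_linear_fst[OF q p]])
  ultimately show ?thesis
    unfolding fine_noise_def
    by (intro centered_add[OF p q] centered_diff[OF p q] centered_scaleR[OF p q] centered_corr)
qed

end

text \<open>A single constant for all applications of the moment estimates: the sum of the
  coefficients listed in \<open>\<kappa>3_ge\<close>. \<open>M4\<close> and \<open>M2\<close> are
  the factors that those estimates return for \<open>c = \<kappa>3\<close> and the weight moment
  \<open>\<kappa>\<^sup>2\<close> of a pair of increments.\<close>

definition \<kappa>3 :: real where
  "\<kappa>3 = 4 * b + 12 * b\<^sup>2 + 4 * b\<^sup>2 * \<tau> + \<kappa>1 + \<kappa>1 * \<tau> + \<kappa>2"

definition M4 :: "real \<Rightarrow> real" where
  "M4 \<kappa> = (4 * \<kappa>3 + 8 * (\<kappa>3 * (\<tau> + 1))\<^sup>2 + 3 * (\<kappa>3 * (\<tau> + 1)) ^ 4 * \<tau>\<^sup>2) * \<kappa>\<^sup>2"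

definition M2 :: "real \<Rightarrow> real" where
  "M2 \<kappa> = (2 * \<kappa>3 + (\<kappa>3 * (\<tau> + 1))\<^sup>2) * \<kappa>\<^sup>2"

lemma \<kappa>3_ge: "0 \<le> \<kappa>3" "2 * b + \<kappa>1 * \<tau> \<le> \<kappa>3" "2 * b + 4 * b\<^sup>2 * \<tau> \<le> \<kappa>3"
  "2 * b + \<kappa>1 + 4 * b\<^sup>2 \<le> \<kappa>3" "4 * b + 12 * b\<^sup>2 + \<kappa>2 \<le> \<kappa>3"
proof -
  have "0 \<le> b" "0 \<le> b\<^sup>2" "0 \<le> b\<^sup>2 * \<tau>" "0 \<le> \<kappa>1" "0 \<le> \<kappa>1 * \<tau>" "0 \<le> \<kappa>2"
    using b_ge constants_ge by auto
  then show "0 \<le> \<kappa>3" "2 * b + \<kappa>1 * \<tau> \<le> \<kappa>3" "2 * b + 4 * b\<^sup>2 * \<tau> \<le> \<kappa>3"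
    "2 * b + \<kappa>1 + 4 * b\<^sup>2 \<le> \<kappa>3" "4 * b + 12 * b\<^sup>2 + \<kappa>2 \<le> \<kappa>3"
    unfolding \<kappa>3_def by linarith+
qed

section \<open>Moments and errors over one coarse step\<close>

context
  fixes s \<kappa> :: real
  assumes s: "0 < s" "s \<le> \<tau>"
begin

abbreviation R2 :: "real^'m \<Rightarrow> real^'m \<Rightarrow> real" where
  "R2 u v \<equiv> increment_weight (s\<^sup>2) u * increment_weight (s\<^sup>2) v"

lemma norm_add_le_R2: "norm (u + v) \<le> 2 * s * R2 u v"
proof -
  have "norm (u + v) \<le> s * increment_weight (s\<^sup>2) u + s * increment_weight (s\<^sup>2) v"
    by (intro norm_triangle_le add_mono norm_le_wt[OF s])
  also have "\<dots> \<le> s * R2 u v + s * R2 u v"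
    using s by (intro add_mono mult_left_mono wt_le_prod[OF s]) auto
  finally show ?thesis by simp
qed

text \<open>The weight of the coarse increment is expressed through those of its two halves, so one
  random factor \<open>R2\<close> controls the fine and the coarse path together.\<close>

lemma increment_weight_add_le: "2 * s\<^sup>2 * increment_weight (2 * s\<^sup>2) (u + v) \<le> 4 * s\<^sup>2 * R2 u v"
proof -
  have "(norm (u + v))\<^sup>2 \<le> (norm u + norm v)\<^sup>2"
    by (intro power_mono norm_triangle_ineq) auto
  also have "\<dots> \<le> 2 * (norm u)\<^sup>2 + 2 * (norm v)\<^sup>2"
    using zero_le_power2[of "norm u - norm v"] by (simp add: power2_sum power2_diff)
  finally have "2 * s\<^sup>2 * increment_weight (2 * s\<^sup>2) (u + v)
      \<le> 2 * (s\<^sup>2 * increment_weight (s\<^sup>2) u) + 2 * (s\<^sup>2 * increment_weight (s\<^sup>2) v)"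
  proof -
    have h: "0 < s\<^sup>2" "0 < 2 * s\<^sup>2"
      using s by simp_all
    show ?thesis if "(norm (u + v))\<^sup>2 \<le> 2 * (norm u)\<^sup>2 + 2 * (norm v)\<^sup>2"
      unfolding increment_weight_scaled[OF h(1)] increment_weight_scaled[OF h(2)] using that h by argo
  qed
  also have "\<dots> \<le> 2 * (s\<^sup>2 * R2 u v) + 2 * (s\<^sup>2 * R2 u v)"
    by (intro add_mono mult_left_mono wt_le_prod[OF s]) auto
  finally show ?thesis by simp
qed

lemma drive_add_bound: "norm (drive x (u + v)) \<le> 2 * b * (1 + norm x) * s * R2 u v"
  by (rule order_trans[OF drive_bound order_trans[OF mult_left_mono[OF norm_add_le_R2]]])
     (use b_ge in auto)

lemma drive_add_lipschitz: "norm (drive x (u + v) - drive y (u + v)) \<le> 2 * b * norm (x - y) * s * R2 u v"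
  by (rule order_trans[OF drive_lipschitz order_trans[OF mult_left_mono[OF norm_add_le_R2]]])
     (use b_ge in auto)

lemma corr_add_bound: "norm (corr (2 * s\<^sup>2) x (u + v)) \<le> 4 * b\<^sup>2 * (1 + norm x) * s\<^sup>2 * R2 u v"
  by (rule order_trans[OF corr_bound order_trans[OF mult_left_mono[OF increment_weight_add_le]]])
     (use s in auto)

lemma corr_add_lipschitz:
  "norm (corr (2 * s\<^sup>2) x (u + v) - corr (2 * s\<^sup>2) y (u + v))
    \<le> 8 * b\<^sup>2 * (1 + norm x) * norm (x - y) * s\<^sup>2 * R2 u v"
  by (rule order_trans[OF corr_lipschitz order_trans[OF mult_left_mono[OF increment_weight_add_le]]])
     (use s in auto)

lemma R2_ge_1: "1 \<le> R2 u v"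
  by (rule wt_le_prod[OF s])

context
  fixes p q :: "(real^'m) pmf"
  assumes p: "increment_law \<kappa> (s\<^sup>2) p" and q: "increment_law \<kappa> (s\<^sup>2) q"
begin

lemmas expectation_R2 = expectation_weight_product[OF p q]

lemma fine_moment_step:
  "measure_pmf.expectation (pair_pmf p q) (\<lambda>z. norm (two_step (s\<^sup>2) x (fst z) (snd z)) ^ 4)
    \<le> norm x ^ 4 + M4 \<kappa> * s\<^sup>2 * (1 + norm x) ^ 4"
proof -
  define X where "X = 1 + norm x"
  define P where "P z = (2 * s\<^sup>2) *\<^sub>R \<mu> x + crude_drift (s\<^sup>2) x (fst z)" for z :: "(real^'m) \<times> (real^'m)"
  define Q where "Q z = drive x (fst z + snd z) + crude_noise (s\<^sup>2) x (fst z) (snd z)" for z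
  have X: "1 \<le> X" by (simp add: X_def)
  have "two_step (s\<^sup>2) x (fst z) (snd z) = x + P z + Q z" for z
    by (simp add: two_step_def two_step_crude P_def Q_def)
  moreover have "measure_pmf.expectation (pair_pmf p q) (\<lambda>z. norm (x + P z + Q z) ^ 4)
      \<le> norm x ^ 4 + (4 * \<kappa>3 + 8 * (\<kappa>3 * (\<tau> + 1))\<^sup>2 + 3 * (\<kappa>3 * (\<tau> + 1)) ^ 4 * \<tau>\<^sup>2) * \<kappa>\<^sup>2 * s\<^sup>2 * X ^ 4"
  proof (rule expectation_perturbed_power4[where R = "\<lambda>z. R2 (fst z) (snd z)"])
    show "measure_pmf.expectation (pair_pmf p q) Q = 0"
      using centered_add[OF p q centered_drive_double[OF p q] centered_crude_noise[OF p q], of x x]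
      by (simp add: centered_def Q_def[abs_def])
    fix z :: "(real^'m) \<times> (real^'m)"
    define r where "r = R2 (fst z) (snd z)"
    have r: "1 \<le> r" unfolding r_def by (rule R2_ge_1)
    have "norm (P z) \<le> (2 * s\<^sup>2) * (b * X) + \<kappa>1 * X * s ^ 3 * r"
      unfolding P_def r_def
    proof (intro norm_triangle_le add_mono)
      show "norm ((2 * s\<^sup>2) *\<^sub>R \<mu> x) \<le> (2 * s\<^sup>2) * (b * X)"
        using drift_bound by (simp add: X_def mult_left_mono)
      show "norm (crude_drift (s\<^sup>2) x (fst z)) \<le> \<kappa>1 * X * s ^ 3 * R2 (fst z) (snd z)"
        unfolding X_def by (rule crude_drift_bound[OF s])
    qed
    also have "\<dots> \<le> (2 * s\<^sup>2) * (b * X) * r + \<kappa>1 * X * (\<tau> * s\<^sup>2) * r"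
    proof (intro add_mono mult_right_mono mult_left_mono)
      show "(2 * s\<^sup>2) * (b * X) \<le> (2 * s\<^sup>2) * (b * X) * r"
        using mult_left_mono[OF r, of "(2 * s\<^sup>2) * (b * X)"] X b_ge by simp
      show "s ^ 3 \<le> \<tau> * s\<^sup>2"
        using s by (simp add: power3_eq_cube power2_eq_square)
    qed (use r X constants_ge in auto)
    also have "\<dots> = (2 * b + \<kappa>1 * \<tau>) * (s\<^sup>2 * X * r)"
      by (simp add: algebra_simps)
    also have "\<dots> \<le> \<kappa>3 * (s\<^sup>2 * X * r)"
      using \<kappa>3_ge X r by (intro mult_right_mono) auto
    finally show "norm (P z) \<le> \<kappa>3 * s\<^sup>2 * X * R2 (fst z) (snd z)"
      by (simp add: r_def ac_simps)
    have "norm (Q z) \<le> 2 * b * X * s * r + \<kappa>1 * X * s\<^sup>2 * r"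
      unfolding Q_def r_def X_def
      by (intro norm_triangle_le add_mono drive_add_bound crude_noise_bound[OF s])
    also have "\<dots> \<le> 2 * b * X * s * r + \<kappa>1 * X * (\<tau> * s) * r"
      using s r X constants_ge
      by (intro add_left_mono mult_right_mono mult_left_mono) (auto simp: power2_eq_square)
    also have "\<dots> = (2 * b + \<kappa>1 * \<tau>) * (s * X * r)"
      by (simp add: algebra_simps)
    also have "\<dots> \<le> \<kappa>3 * (s * X * r)"
      using \<kappa>3_ge X r s by (intro mult_right_mono) auto
    finally show "norm (Q z) \<le> \<kappa>3 * s * X * R2 (fst z) (snd z)"
      by (simp add: r_def ac_simps)
  qed (use finite_set_pair[OF p q] s \<kappa>3_ge expectation_R2 R2_ge_1 in \<open>auto simp: X_def\<close>)
  ultimately show ?thesis by (simp add: M4_def X_def)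
qed

lemma coarse_moment_step:
  "measure_pmf.expectation (pair_pmf p q) (\<lambda>z. norm (step (2 * s\<^sup>2) x (fst z + snd z)) ^ 4)
    \<le> norm x ^ 4 + M4 \<kappa> * s\<^sup>2 * (1 + norm x) ^ 4"
proof -
  define X where "X = 1 + norm x"
  define P :: "(real^'m) \<times> (real^'m) \<Rightarrow> real^'d" where "P z = (2 * s\<^sup>2) *\<^sub>R \<mu> x" for z
  define Q where "Q z = drive x (fst z + snd z) + corr (2 * s\<^sup>2) x (fst z + snd z)" for z
  have X: "1 \<le> X" by (simp add: X_def)
  have "step (2 * s\<^sup>2) x (fst z + snd z) = x + P z + Q z" for z
    by (simp add: step_def P_def Q_def)
  moreover have "measure_pmf.expectation (pair_pmf p q) (\<lambda>z. norm (x + P z + Q z) ^ 4)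
      \<le> norm x ^ 4 + (4 * \<kappa>3 + 8 * (\<kappa>3 * (\<tau> + 1))\<^sup>2 + 3 * (\<kappa>3 * (\<tau> + 1)) ^ 4 * \<tau>\<^sup>2) * \<kappa>\<^sup>2 * s\<^sup>2 * X ^ 4"
  proof (rule expectation_perturbed_power4[where R = "\<lambda>z. R2 (fst z) (snd z)"])
    show "measure_pmf.expectation (pair_pmf p q) Q = 0"
      using centered_add[OF p q centered_drive_double[OF p q] centered_corr_double[OF p q], of x x]
      by (simp add: centered_def Q_def[abs_def])
    fix z :: "(real^'m) \<times> (real^'m)"
    define r where "r = R2 (fst z) (snd z)"
    have r: "1 \<le> r" unfolding r_def by (rule R2_ge_1)
    have "norm (P z) \<le> (2 * s\<^sup>2) * (b * X)"
      using drift_bound by (simp add: P_def X_def mult_left_mono)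
    also have "\<dots> = (2 * b) * (s\<^sup>2 * X * 1)"
      by simp
    also have "\<dots> \<le> \<kappa>3 * (s\<^sup>2 * X * r)"
      using \<kappa>3_ge X r constants_ge b_ge by (intro mult_mono) (auto intro: order_trans[rotated])
    finally show "norm (P z) \<le> \<kappa>3 * s\<^sup>2 * X * R2 (fst z) (snd z)"
      by (simp add: r_def ac_simps)
    have "norm (Q z) \<le> 2 * b * X * s * r + 4 * b\<^sup>2 * X * s\<^sup>2 * r"
      unfolding Q_def r_def X_def
      by (intro norm_triangle_le add_mono drive_add_bound corr_add_bound)
    also have "\<dots> \<le> 2 * b * X * s * r + 4 * b\<^sup>2 * X * (\<tau> * s) * r"
      using s r X constants_ge
      by (intro add_left_mono mult_right_mono mult_left_mono) (auto simp: power2_eq_square)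
    also have "\<dots> = (2 * b + 4 * b\<^sup>2 * \<tau>) * (s * X * r)"
      by (simp add: algebra_simps)
    also have "\<dots> \<le> \<kappa>3 * (s * X * r)"
      using \<kappa>3_ge X r s by (intro mult_right_mono) auto
    finally show "norm (Q z) \<le> \<kappa>3 * s * X * R2 (fst z) (snd z)"
      by (simp add: r_def ac_simps)
  qed (use finite_set_pair[OF p q] s \<kappa>3_ge expectation_R2 R2_ge_1 in \<open>auto simp: X_def\<close>)
  ultimately show ?thesis by (simp add: M4_def X_def)
qed

text \<open>The corrections of the two schemes are not compared with each other. Each is centred and
  of size \<open>s\<^sup>2 * X\<close>, that is \<open>s\<close> times the part \<open>s * X\<close>
  of the source, which is affordable because a single path error only has to be of order
  \<open>s\<close> in the fourth mean.\<close>

lemma fine_coarse_step: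
  assumes X: "1 + norm x \<le> X" "1 + norm y \<le> X"
  shows "measure_pmf.expectation (pair_pmf p q)
      (\<lambda>z. norm (two_step (s\<^sup>2) x (fst z) (snd z) - step (2 * s\<^sup>2) y (fst z + snd z)) ^ 4)
    \<le> norm (x - y) ^ 4 + M4 \<kappa> * s\<^sup>2 * (norm (x - y) + s * X) ^ 4"
proof -
  define \<delta> where "\<delta> = norm (x - y)"
  define Y where "Y = \<delta> + s * X"
  define P where "P z = (2 * s\<^sup>2) *\<^sub>R (\<mu> x - \<mu> y) + crude_drift (s\<^sup>2) x (fst z)" for z :: "(real^'m) \<times> (real^'m)"
  define Q where "Q z = (drive x (fst z + snd z) - drive y (fst z + snd z))
      + crude_noise (s\<^sup>2) x (fst z) (snd z) - corr (2 * s\<^sup>2) y (fst z + snd z)" for z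
  have X1: "1 \<le> X" using X norm_ge_zero[of x] by linarith
  have \<delta>: "0 \<le> \<delta>" by (simp add: \<delta>_def)
  have Y: "\<delta> \<le> Y" "s * X \<le> Y" "0 \<le> Y"
    using s X1 \<delta> by (simp_all add: Y_def)
  have "two_step (s\<^sup>2) x (fst z) (snd z) - step (2 * s\<^sup>2) y (fst z + snd z) = (x - y) + P z + Q z" for z
    by (simp add: two_step_def two_step_crude step_def[of "2 * s\<^sup>2"] P_def Q_def scaleR_diff_right)
  moreover have "measure_pmf.expectation (pair_pmf p q) (\<lambda>z. norm ((x - y) + P z + Q z) ^ 4)
      \<le> norm (x - y) ^ 4 + (4 * \<kappa>3 + 8 * (\<kappa>3 * (\<tau> + 1))\<^sup>2 + 3 * (\<kappa>3 * (\<tau> + 1)) ^ 4 * \<tau>\<^sup>2) * \<kappa>\<^sup>2 * s\<^sup>2 * Y ^ 4"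
  proof (rule expectation_perturbed_power4[where R = "\<lambda>z. R2 (fst z) (snd z)"])
    have "centered p q (\<lambda>u v. (drive x (u + v) - drive y (u + v)) + crude_noise (s\<^sup>2) x u v
        - corr (2 * s\<^sup>2) y (u + v))"
      by (intro centered_add[OF p q] centered_diff[OF p q] centered_drive_double[OF p q]
          centered_crude_noise[OF p q] centered_corr_double[OF p q])
    then show "measure_pmf.expectation (pair_pmf p q) Q = 0"
      by (simp add: centered_def Q_def[abs_def])
    fix z :: "(real^'m) \<times> (real^'m)"
    define r where "r = R2 (fst z) (snd z)"
    have r: "1 \<le> r" unfolding r_def by (rule R2_ge_1)
    have "norm (P z) \<le> (2 * s\<^sup>2) * (b * \<delta>) + \<kappa>1 * X * s ^ 3 * r"
      unfolding P_def r_def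
    proof (intro norm_triangle_le add_mono)
      show "norm ((2 * s\<^sup>2) *\<^sub>R (\<mu> x - \<mu> y)) \<le> (2 * s\<^sup>2) * (b * \<delta>)"
        using drift_lipschitz by (simp add: \<delta>_def mult_left_mono)
      have "\<kappa>1 * (1 + norm x) * s ^ 3 * R2 (fst z) (snd z) \<le> \<kappa>1 * X * s ^ 3 * R2 (fst z) (snd z)"
        using X s r constants_ge unfolding r_def by (intro mult_right_mono mult_left_mono) auto
      then show "norm (crude_drift (s\<^sup>2) x (fst z)) \<le> \<kappa>1 * X * s ^ 3 * R2 (fst z) (snd z)"
        using crude_drift_bound[OF s, of x "fst z" "snd z"] by linarith
    qed
    also have "\<dots> = (2 * s\<^sup>2 * b) * (\<delta> * 1) + (\<kappa>1 * s\<^sup>2) * (s * X * r)"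
      by (simp add: power3_eq_cube power2_eq_square)
    also have "\<dots> \<le> (2 * s\<^sup>2 * b) * (Y * r) + (\<kappa>1 * s\<^sup>2) * (Y * r)"
      using Y r b_ge constants_ge by (intro add_mono mult_left_mono mult_mono) auto
    also have "\<dots> = (2 * b + \<kappa>1) * (s\<^sup>2 * Y * r)"
      by (simp add: algebra_simps)
    also have "\<dots> \<le> \<kappa>3 * (s\<^sup>2 * Y * r)"
      using \<kappa>3_ge(4) constants_ge Y r by (intro mult_right_mono) (auto intro: order_trans[rotated])
    finally show "norm (P z) \<le> \<kappa>3 * s\<^sup>2 * Y * R2 (fst z) (snd z)"
      by (simp add: r_def ac_simps)
    have "norm (Q z) \<le> 2 * b * \<delta> * s * r + \<kappa>1 * X * s\<^sup>2 * r + 4 * b\<^sup>2 * X * s\<^sup>2 * r"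
    proof -
      have "\<kappa>1 * (1 + norm x) * s\<^sup>2 * r \<le> \<kappa>1 * X * s\<^sup>2 * r"
        "4 * b\<^sup>2 * (1 + norm y) * s\<^sup>2 * r \<le> 4 * b\<^sup>2 * X * s\<^sup>2 * r"
        using X r constants_ge by (auto intro!: mult_right_mono mult_left_mono)
      then have "norm (crude_noise (s\<^sup>2) x (fst z) (snd z)) \<le> \<kappa>1 * X * s\<^sup>2 * r"
        "norm (corr (2 * s\<^sup>2) y (fst z + snd z)) \<le> 4 * b\<^sup>2 * X * s\<^sup>2 * r"
        using crude_noise_bound[OF s, of x "fst z" "snd z"] corr_add_bound[of y "fst z" "snd z"]
        unfolding r_def by linarith+
      then show ?thesis
        using drive_add_lipschitz[of x "fst z" "snd z" y]
          norm_triangle_ineq[of "drive x (fst z + snd z) - drive y (fst z + snd z)"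
            "crude_noise (s\<^sup>2) x (fst z) (snd z)"]
          norm_triangle_ineq4[of "drive x (fst z + snd z) - drive y (fst z + snd z)
            + crude_noise (s\<^sup>2) x (fst z) (snd z)" "corr (2 * s\<^sup>2) y (fst z + snd z)"]
        unfolding Q_def r_def \<delta>_def by linarith
    qed
    also have "\<dots> = (2 * b * s) * (\<delta> * r) + (\<kappa>1 * s) * (s * X * r) + (4 * b\<^sup>2 * s) * (s * X * r)"
      by (simp add: power2_eq_square)
    also have "\<dots> \<le> (2 * b * s) * (Y * r) + (\<kappa>1 * s) * (Y * r) + (4 * b\<^sup>2 * s) * (Y * r)"
      using Y r b_ge constants_ge s by (intro add_mono mult_left_mono mult_mono) auto
    also have "\<dots> = (2 * b + \<kappa>1 + 4 * b\<^sup>2) * (s * Y * r)"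
      by (simp add: algebra_simps)
    also have "\<dots> \<le> \<kappa>3 * (s * Y * r)"
      using \<kappa>3_ge Y r s by (intro mult_right_mono) auto
    finally show "norm (Q z) \<le> \<kappa>3 * s * Y * R2 (fst z) (snd z)"
      by (simp add: r_def ac_simps)
  qed (use finite_set_pair[OF p q] s \<kappa>3_ge expectation_R2 R2_ge_1 Y in \<open>auto simp: \<delta>_def\<close>)
  ultimately show ?thesis by (simp add: M4_def Y_def \<delta>_def)
qed

text \<open>The source is chosen so that its square is controlled by the Lyapunov function: the
  average error enters linearly, the single errors only squared. That holds because smooth
  coefficients are averaged to second order and the Levy areas survive only as a difference.\<close>

lemma antithetic_average_step:
  assumes X: "1 + norm x \<le> X" "1 + norm y \<le> X"
  shows "measure_pmf.expectation (pair_pmf p q)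
      (\<lambda>z. (norm ((1/2) *\<^sub>R (two_step (s\<^sup>2) x (fst z) (snd z) + two_step (s\<^sup>2) y (snd z) (fst z))
        - step (2 * s\<^sup>2) w (fst z + snd z)))\<^sup>2)
    \<le> (norm ((1/2) *\<^sub>R (x + y) - w))\<^sup>2 + M2 \<kappa> * s\<^sup>2
      * (norm ((1/2) *\<^sub>R (x + y) - w) + (norm (x - w))\<^sup>2 + (norm (y - w))\<^sup>2 + s\<^sup>2 * X\<^sup>2)\<^sup>2"
proof -
  define e where "e = (1/2) *\<^sub>R (x + y) - w"
  define Y where "Y = norm e + (norm (x - w))\<^sup>2 + (norm (y - w))\<^sup>2 + s\<^sup>2 * X\<^sup>2"
  define P where "P z = (2 * s\<^sup>2) *\<^sub>R ((1/2) *\<^sub>R (\<mu> x + \<mu> y) - \<mu> w)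
      + (1/2) *\<^sub>R (fine_drift (s\<^sup>2) x (fst z) + fine_drift (s\<^sup>2) y (snd z))" for z :: "(real^'m) \<times> (real^'m)"
  \<comment> \<open>The noise in four parts: the averaged drive, the corrections against the coarse
    one, the surviving difference of Levy terms, and the higher order remainders.\<close>
  define q1 where "q1 u v = (1/2) *\<^sub>R (drive x (u + v) + drive y (u + v)) - drive w (u + v)" for u v
  define q2 where "q2 u v = (1/2) *\<^sub>R ((corr (2 * s\<^sup>2) x (u + v) - corr (2 * s\<^sup>2) w (u + v))
      + (corr (2 * s\<^sup>2) y (u + v) - corr (2 * s\<^sup>2) w (u + v)))" for u v
  define q3 where "q3 u v = (1/2) *\<^sub>R (levy x u v - levy y u v)" for u v
  define q4 where "q4 u v = (1/2) *\<^sub>R (fine_noise (s\<^sup>2) x u v + fine_noise (s\<^sup>2) y v u)" for u v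
  define Q where "Q z = q1 (fst z) (snd z) + q2 (fst z) (snd z) + q3 (fst z) (snd z) + q4 (fst z) (snd z)" for z
  have X1: "1 \<le> X" using X norm_ge_zero[of x] by linarith
  \<comment> \<open>A Lipschitz constant growing like \<open>X\<close> gives terms
    \<open>s\<^sup>2 * X * t\<close>, with \<open>t\<close> a path error. One factor
    \<open>s\<close> is the size granted to the noise, and the rest is split here into squares
    already present in \<open>Y\<close>.\<close>
  have sX: "s * X * t \<le> t\<^sup>2 + s\<^sup>2 * X\<^sup>2" if "0 \<le> t" for t
  proof -
    have "2 * (s * X * t) \<le> t\<^sup>2 + (s * X)\<^sup>2"
      using zero_le_power2[of "s * X - t"] by (simp add: power2_diff)
    moreover have "0 \<le> s * X * t" using s X1 that by simp
    ultimately show ?thesis by (simp add: power_mult_distrib)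
  qed
  have Y: "norm e \<le> Y" "0 \<le> Y" "s\<^sup>2 * X\<^sup>2 \<le> Y"
      "norm e + 2 * ((norm (x - w))\<^sup>2 + (norm (y - w))\<^sup>2) \<le> 2 * Y"
      "s * X * norm (x - w) \<le> Y" "s * X * norm (y - w) \<le> Y"
  proof -
    have "0 \<le> norm e" "0 \<le> (norm (x - w))\<^sup>2" "0 \<le> (norm (y - w))\<^sup>2" "0 \<le> s\<^sup>2 * X\<^sup>2"
      by simp_all
    then show "norm e \<le> Y" "0 \<le> Y" "s\<^sup>2 * X\<^sup>2 \<le> Y"
      "norm e + 2 * ((norm (x - w))\<^sup>2 + (norm (y - w))\<^sup>2) \<le> 2 * Y"
      "s * X * norm (x - w) \<le> Y" "s * X * norm (y - w) \<le> Y"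
      using sX[OF norm_ge_zero, of "x - w"] sX[OF norm_ge_zero, of "y - w"]
      unfolding Y_def by argo+
  qed
  \<comment> \<open>At \<open>y\<close> the fine decomposition is applied with the increments
    exchanged: the coarse increment is unchanged, and the Levy term changes sign.\<close>
  have "(1/2) *\<^sub>R (two_step (s\<^sup>2) x (fst z) (snd z) + two_step (s\<^sup>2) y (snd z) (fst z))
        - step (2 * s\<^sup>2) w (fst z + snd z) = e + P z + Q z" for z
    unfolding two_step_def two_step_fine add.commute[of "snd z" "fst z"] levy_swap[of y "snd z" "fst z"]
    by (simp add: step_def e_def P_def Q_def q1_def q2_def q3_def q4_def vec_eq_iff field_simps)
  moreover have "measure_pmf.expectation (pair_pmf p q) (\<lambda>z. (norm (e + P z + Q z))\<^sup>2)
      \<le> (norm e)\<^sup>2 + (2 * \<kappa>3 + (\<kappa>3 * (\<tau> + 1))\<^sup>2) * \<kappa>\<^sup>2 * s\<^sup>2 * Y\<^sup>2"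
  proof (rule expectation_perturbed_power2[where R = "\<lambda>z. (R2 (fst z) (snd z))\<^sup>2"])
    have "centered p q (\<lambda>u v. q1 u v + q2 u v + q3 u v + q4 u v)"
      unfolding q1_def q2_def q3_def q4_def
      by (intro centered_add[OF p q] centered_diff[OF p q] centered_scaleR[OF p q]
          centered_drive_double[OF p q] centered_corr_double[OF p q] centered_levy[OF p q]
          centered_fine_noise[OF p q] centered_swap[OF p q centered_fine_noise[OF q p]])
    then show "measure_pmf.expectation (pair_pmf p q) Q = 0"
      by (simp add: centered_def Q_def[abs_def])
    fix z :: "(real^'m) \<times> (real^'m)"
    define u v where "u = fst z" and "v = snd z"
    define r where "r = R2 u v"
    have r: "1 \<le> r" "r \<le> r\<^sup>2" "1 \<le> r\<^sup>2"
      using R2_ge_1[of u v] by (auto simp: r_def intro: self_le_power)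
    have r': "increment_weight (s\<^sup>2) v * increment_weight (s\<^sup>2) u = r"
      by (simp add: r_def)
    have X2: "(1 + norm x)\<^sup>2 \<le> X\<^sup>2" "(1 + norm y)\<^sup>2 \<le> X\<^sup>2"
      using X by (auto intro!: power_mono)
    have XY: "\<kappa>2 * X\<^sup>2 * s ^ 3 * r\<^sup>2 \<le> \<kappa>2 * (s * Y * r\<^sup>2)" "\<kappa>2 * X\<^sup>2 * s ^ 4 * r\<^sup>2 \<le> \<kappa>2 * (s\<^sup>2 * Y * r\<^sup>2)"
    proof -
      have "\<kappa>2 * (s * (s\<^sup>2 * X\<^sup>2) * r\<^sup>2) \<le> \<kappa>2 * (s * Y * r\<^sup>2)"
        using Y s constants_ge by (intro mult_left_mono mult_right_mono) auto
      then show "\<kappa>2 * X\<^sup>2 * s ^ 3 * r\<^sup>2 \<le> \<kappa>2 * (s * Y * r\<^sup>2)"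
        by (simp add: eval_nat_numeral ac_simps)
      have "\<kappa>2 * (s\<^sup>2 * (s\<^sup>2 * X\<^sup>2) * r\<^sup>2) \<le> \<kappa>2 * (s\<^sup>2 * Y * r\<^sup>2)"
        using Y s constants_ge by (intro mult_left_mono mult_right_mono) auto
      then show "\<kappa>2 * X\<^sup>2 * s ^ 4 * r\<^sup>2 \<le> \<kappa>2 * (s\<^sup>2 * Y * r\<^sup>2)"
        by (simp add: eval_nat_numeral ac_simps)
    qed
    have half_add: "norm ((1/2) *\<^sub>R (a + a')) \<le> B" if "norm a \<le> B" "norm a' \<le> B" for a a' :: "real^'d" and B
      using norm_triangle_le[OF add_mono[OF that]] by simp
    have fine_drift: "norm ((1/2) *\<^sub>R (fine_drift (s\<^sup>2) x u + fine_drift (s\<^sup>2) y v)) \<le> \<kappa>2 * (s\<^sup>2 * Y * r\<^sup>2)"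
    proof (rule half_add)
      have "\<kappa>2 * (1 + norm x)\<^sup>2 * s ^ 4 * r\<^sup>2 \<le> \<kappa>2 * X\<^sup>2 * s ^ 4 * r\<^sup>2"
        "\<kappa>2 * (1 + norm y)\<^sup>2 * s ^ 4 * r\<^sup>2 \<le> \<kappa>2 * X\<^sup>2 * s ^ 4 * r\<^sup>2"
        using X2 constants_ge by (auto intro!: mult_left_mono mult_right_mono)
      then show "norm (fine_drift (s\<^sup>2) x u) \<le> \<kappa>2 * (s\<^sup>2 * Y * r\<^sup>2)" "norm (fine_drift (s\<^sup>2) y v) \<le> \<kappa>2 * (s\<^sup>2 * Y * r\<^sup>2)"
        using fine_drift_bound[OF s, of x u v] fine_drift_bound[OF s, of y v u] XY unfolding r' r_def[symmetric]
        by linarith+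
    qed
    have q4: "norm (q4 u v) \<le> \<kappa>2 * (s * Y * r\<^sup>2)"
      unfolding q4_def
    proof (rule half_add)
      have "\<kappa>2 * (1 + norm x)\<^sup>2 * s ^ 3 * r\<^sup>2 \<le> \<kappa>2 * X\<^sup>2 * s ^ 3 * r\<^sup>2"
        "\<kappa>2 * (1 + norm y)\<^sup>2 * s ^ 3 * r\<^sup>2 \<le> \<kappa>2 * X\<^sup>2 * s ^ 3 * r\<^sup>2"
        using X2 constants_ge s by (auto intro!: mult_left_mono mult_right_mono)
      then show "norm (fine_noise (s\<^sup>2) x u v) \<le> \<kappa>2 * (s * Y * r\<^sup>2)" "norm (fine_noise (s\<^sup>2) y v u) \<le> \<kappa>2 * (s * Y * r\<^sup>2)"
        using fine_noise_bound[OF s, of x u v] fine_noise_bound[OF s, of y v u] XY unfolding r' r_def[symmetric]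
        by linarith+
    qed
    have average: "norm ((1/2) *\<^sub>R (g x + g y) - g w) \<le> K * (2 * Y)" if "smooth_bounded K g D"
      for g :: "real^'d \<Rightarrow> real^'d" and D
      by (rule order_trans[OF smooth_average_bound[OF that] mult_left_mono]) (use Y K in \<open>auto simp: e_def\<close>)
    have "norm (P z) \<le> (2 * s\<^sup>2) * (b * (2 * Y)) + \<kappa>2 * (s\<^sup>2 * Y * r\<^sup>2)"
      unfolding P_def u_def[symmetric] v_def[symmetric]
    proof (intro norm_triangle_le add_mono fine_drift)
      have "K * (2 * Y) \<le> b * (2 * Y)"
        using b_ge Y by (intro mult_right_mono) auto
      then have "norm ((1/2) *\<^sub>R (\<mu> x + \<mu> y) - \<mu> w) \<le> b * (2 * Y)"
        using average[OF \<mu>] by linarith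
      then show "norm ((2 * s\<^sup>2) *\<^sub>R ((1/2) *\<^sub>R (\<mu> x + \<mu> y) - \<mu> w)) \<le> (2 * s\<^sup>2) * (b * (2 * Y))"
        unfolding norm_scaleR by (intro mult_mono) auto
    qed
    also have "\<dots> = (4 * b) * (s\<^sup>2 * Y * 1) + \<kappa>2 * (s\<^sup>2 * Y * r\<^sup>2)"
      by simp
    also have "\<dots> \<le> (4 * b) * (s\<^sup>2 * Y * r\<^sup>2) + \<kappa>2 * (s\<^sup>2 * Y * r\<^sup>2)"
      using b_ge Y r by (intro add_right_mono mult_left_mono) auto
    also have "\<dots> = (4 * b + \<kappa>2) * (s\<^sup>2 * Y * r\<^sup>2)"
      by (simp add: algebra_simps)
    also have "\<dots> \<le> \<kappa>3 * (s\<^sup>2 * Y * r\<^sup>2)"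
      using \<kappa>3_ge(5) constants_ge(2) Y by (intro mult_right_mono) auto
    finally show "norm (P z) \<le> \<kappa>3 * s\<^sup>2 * Y * (R2 (fst z) (snd z))\<^sup>2"
      by (simp add: r_def u_def v_def ac_simps)
    have q1: "norm (q1 u v) \<le> 4 * b * (s * Y * r)"
    proof -
      \<comment> \<open>All three paths share the increment \<open>u + v\<close>, so the average can
        be formed inside the diffusion coefficients, where the midpoint estimate applies.\<close>
      have "q1 u v = (\<Sum>j\<in>UNIV. ((u + v) $ j) *\<^sub>R ((1/2) *\<^sub>R (\<sigma> j x + \<sigma> j y) - \<sigma> j w))"
        unfolding q1_def drive_def
        by (simp add: scaleR_diff_right scaleR_add_right scaleR_sum_right sum.distrib sum_subtractf ac_simps
            del: vector_add_component)
      also have "norm \<dots> \<le> real CARD('m) * (norm (u + v) * (K * (2 * Y)))"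
        by (intro norm_sum_components_le average[OF \<sigma>])
      also have "\<dots> = (b * (2 * Y)) * norm (u + v)"
        by (simp add: b_def)
      also have "\<dots> \<le> (b * (2 * Y)) * (2 * s * r)"
        using norm_add_le_R2[of u v] b_ge Y by (intro mult_left_mono) (auto simp: r_def)
      finally show ?thesis by (simp add: ac_simps)
    qed
    have q2: "norm (q2 u v) \<le> 8 * b\<^sup>2 * (s * Y * r)"
      unfolding q2_def
    proof (rule half_add)
      have "norm (corr (2 * s\<^sup>2) a (u + v) - corr (2 * s\<^sup>2) w (u + v)) \<le> 8 * b\<^sup>2 * (s * Y * r)"
        if "1 + norm a \<le> X" "s * X * norm (a - w) \<le> Y" for a
      proof -
        have "norm (corr (2 * s\<^sup>2) a (u + v) - corr (2 * s\<^sup>2) w (u + v))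
            \<le> 8 * b\<^sup>2 * (1 + norm a) * norm (a - w) * s\<^sup>2 * r"
          unfolding r_def by (rule corr_add_lipschitz)
        also have "\<dots> \<le> 8 * b\<^sup>2 * X * norm (a - w) * s\<^sup>2 * r"
          using that r by (intro mult_right_mono mult_left_mono) auto
        also have "\<dots> = 8 * b\<^sup>2 * (s * (s * X * norm (a - w)) * r)"
          by (simp add: power2_eq_square)
        also have "\<dots> \<le> 8 * b\<^sup>2 * (s * Y * r)"
          using that s r by (intro mult_left_mono mult_right_mono) auto
        finally show ?thesis .
      qed
      with X Y show "norm (corr (2 * s\<^sup>2) x (u + v) - corr (2 * s\<^sup>2) w (u + v)) \<le> 8 * b\<^sup>2 * (s * Y * r)"
        "norm (corr (2 * s\<^sup>2) y (u + v) - corr (2 * s\<^sup>2) w (u + v)) \<le> 8 * b\<^sup>2 * (s * Y * r)"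
        by blast+
    qed
    have q3: "norm (q3 u v) \<le> 4 * b\<^sup>2 * (s * Y * r)"
    proof -
      have cross: "norm (cross x a a' - cross y a a') \<le> 4 * b\<^sup>2 * (s * Y * r)"
        if "norm a * norm a' \<le> s\<^sup>2 * r" for a a'
      proof -
        have "norm (cross x a a' - cross y a a') \<le> 2 * b\<^sup>2 * (1 + norm x) * norm (x - y) * (norm a * norm a')"
          by (rule cross_lipschitz)
        also have "\<dots> \<le> 2 * b\<^sup>2 * X * (norm (x - w) + norm (y - w)) * (s\<^sup>2 * r)"
        proof (rule mult_mono[OF mult_mono[OF mult_left_mono] that])
          show "norm (x - y) \<le> norm (x - w) + norm (y - w)"
            by (rule norm_diff_triangle_le[of x w _ y]) (auto simp: norm_minus_commute)
        qed (use X X1 in auto)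
        also have "\<dots> = 2 * b\<^sup>2 * (s * (s * X * norm (x - w) + s * X * norm (y - w)) * r)"
          by (simp add: power2_eq_square algebra_simps)
        also have "\<dots> \<le> 2 * b\<^sup>2 * (s * (Y + Y) * r)"
          using Y s r by (intro mult_left_mono mult_right_mono add_mono) auto
        finally show ?thesis by (simp add: ac_simps)
      qed
      have uv: "norm u * norm v \<le> s\<^sup>2 * r"
      proof -
        have "norm u * norm v \<le> (s * increment_weight (s\<^sup>2) u) * (s * increment_weight (s\<^sup>2) v)"
          using s wt_ge_1[OF s, of u] by (intro mult_mono norm_le_wt[OF s]) auto
        then show ?thesis by (simp add: r_def power2_eq_square ac_simps)
      qed
      \<comment> \<open>Terms are paired with equal increments and different states, so the
        Lipschitz bound in the state applies; the distance from \<open>x\<close> to \<open>y\<close>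
        is then measured through \<open>w\<close>.\<close>
      have "q3 u v = (1/2) *\<^sub>R ((1/2) *\<^sub>R ((cross x v u - cross y v u) + - (cross x u v - cross y u v)))"
        by (simp add: q3_def levy_def algebra_simps)
      also have "norm \<dots> \<le> 4 * b\<^sup>2 * (s * Y * r)"
      proof (rule half_scaleR_le[OF half_add])
        show "norm (cross x v u - cross y v u) \<le> 4 * b\<^sup>2 * (s * Y * r)"
          using uv by (intro cross) (simp add: mult.commute)
        show "norm (- (cross x u v - cross y u v)) \<le> 4 * b\<^sup>2 * (s * Y * r)"
          unfolding norm_minus_cancel by (intro cross uv)
      qed
      finally show ?thesis .
    qed
    have "norm (Q z) \<le> 4 * b * (s * Y * r) + 8 * b\<^sup>2 * (s * Y * r) + 4 * b\<^sup>2 * (s * Y * r) + \<kappa>2 * (s * Y * r\<^sup>2)"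
      unfolding Q_def u_def[symmetric] v_def[symmetric]
      by (intro norm_triangle_le add_mono q1 q2 q3 q4)
    also have "\<dots> \<le> 4 * b * (s * Y * r\<^sup>2) + 8 * b\<^sup>2 * (s * Y * r\<^sup>2) + 4 * b\<^sup>2 * (s * Y * r\<^sup>2) + \<kappa>2 * (s * Y * r\<^sup>2)"
      using r b_ge s Y by (intro add_mono mult_left_mono order_refl) auto
    also have "\<dots> = (4 * b + 12 * b\<^sup>2 + \<kappa>2) * (s * Y * r\<^sup>2)"
      by (simp add: algebra_simps)
    also have "\<dots> \<le> \<kappa>3 * (s * Y * r\<^sup>2)"
      using \<kappa>3_ge Y r s by (intro mult_right_mono) auto
    finally show "norm (Q z) \<le> \<kappa>3 * s * Y * (R2 (fst z) (snd z))\<^sup>2"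
      by (simp add: r_def u_def v_def ac_simps)
    show "1 \<le> (R2 (fst z) (snd z))\<^sup>2"
      using r by (simp add: r_def u_def v_def)
  next
    show "measure_pmf.expectation (pair_pmf p q) (\<lambda>z. ((R2 (fst z) (snd z))\<^sup>2)\<^sup>2) \<le> \<kappa>\<^sup>2"
      using expectation_R2 s by (simp flip: power_mult)
  qed (use finite_set_pair[OF p q] s \<kappa>3_ge Y in auto)
  ultimately show ?thesis by (simp add: M2_def Y_def e_def)
qed

end

end

text \<open>The 260 belongs to the squared average error; 1232 = 2 * 520 + 3 * 64 collects the two
  fourth power errors and the three fourth moments.\<close>

definition growth :: "real \<Rightarrow> real" where
  "growth \<kappa> = 260 * M2 \<kappa> + 1232 * M4 \<kappa>"

lemma M_nonneg: "0 \<le> M2 \<kappa>" "0 \<le> M4 \<kappa>" "0 \<le> growth \<kappa>"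
  using \<kappa>3_ge(1) by (auto simp: M2_def M4_def growth_def)

lemma lyapunov_step:
  assumes s: "0 < s" "s \<le> \<tau>" and p: "increment_law \<kappa> (s\<^sup>2) p" and q: "increment_law \<kappa> (s\<^sup>2) q"
  shows "measure_pmf.expectation (pair_pmf p q) (\<lambda>z. lyapunov s (two_step (s\<^sup>2) x (fst z) (snd z))
      (two_step (s\<^sup>2) y (snd z) (fst z)) (step (2 * s\<^sup>2) w (fst z + snd z)))
    \<le> (1 + growth \<kappa> * s\<^sup>2) * lyapunov s x y w"
proof -
  let ?E = "measure_pmf.expectation (pair_pmf p q)"
  define X where "X = 1 + norm x + norm y + norm w"
  define V where "V = lyapunov s x y w"
  note int = integrable_increment[OF p q]
  have X: "1 + norm x \<le> X" "1 + norm y \<le> X" "1 + norm w \<le> X"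
    by (simp_all add: X_def)
  \<comment> \<open>The antithetic path uses the increments in reverse order, so the estimates for
    the fine path hold for it with \<open>p\<close> and \<open>q\<close> exchanged.\<close>
  have swap: "?E (\<lambda>z. f (snd z) (fst z)) = measure_pmf.expectation (pair_pmf q p) (\<lambda>z. f (fst z) (snd z))"
    for f :: "real^'m \<Rightarrow> real^'m \<Rightarrow> real"
    by (subst pair_commute_pmf) (simp add: case_prod_beta)
  note V_bounds = lyapunov_bounds[where s = s and x = x and y = y and w = w, folded X_def V_def]
  define r where "r = M4 \<kappa> * s\<^sup>2"
  have r: "0 \<le> r" using M_nonneg by (simp add: r_def)
  have moment: "s ^ 4 * (t + r * (1 + norm a) ^ 4) \<le> s ^ 4 * t + 64 * (r * V)" if "1 + norm a \<le> X" for a :: "real^'d" and t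
  proof -
    have "r * (s ^ 4 * (1 + norm a) ^ 4) \<le> r * (64 * V)"
      using that by (intro mult_left_mono[OF _ r] order_trans[OF mult_left_mono V_bounds(2)] power_mono) auto
    then show ?thesis by (simp add: algebra_simps)
  qed
  have 1: "?E (\<lambda>z. norm (two_step (s\<^sup>2) x (fst z) (snd z)) ^ 4) \<le> norm x ^ 4 + r * (1 + norm x) ^ 4"
    unfolding r_def by (rule fine_moment_step[OF s p q])
  have 2: "?E (\<lambda>z. norm (two_step (s\<^sup>2) y (snd z) (fst z)) ^ 4) \<le> norm y ^ 4 + r * (1 + norm y) ^ 4"
    unfolding r_def using fine_moment_step[OF s q p, of y] swap[of "\<lambda>v u. norm (two_step (s\<^sup>2) y v u) ^ 4"] by simp
  have 3: "?E (\<lambda>z. norm (step (2 * s\<^sup>2) w (fst z + snd z)) ^ 4) \<le> norm w ^ 4 + r * (1 + norm w) ^ 4"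
    unfolding r_def by (rule coarse_moment_step[OF s p q])
  have 4: "?E (\<lambda>z. norm (two_step (s\<^sup>2) x (fst z) (snd z) - step (2 * s\<^sup>2) w (fst z + snd z)) ^ 4)
      \<le> norm (x - w) ^ 4 + r * (520 * V)"
    using fine_coarse_step[OF s p q X(1,3)] mult_left_mono[OF V_bounds(3) r] unfolding r_def by linarith
  have 5: "?E (\<lambda>z. norm (two_step (s\<^sup>2) y (snd z) (fst z) - step (2 * s\<^sup>2) w (fst z + snd z)) ^ 4)
      \<le> norm (y - w) ^ 4 + r * (520 * V)"
    using fine_coarse_step[OF s q p X(2,3)] mult_left_mono[OF V_bounds(4) r]
      swap[of "\<lambda>v u. norm (two_step (s\<^sup>2) y v u - step (2 * s\<^sup>2) w (v + u)) ^ 4"]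
    unfolding r_def by (simp add: add.commute)
  have "M2 \<kappa> * s\<^sup>2 * (norm ((1/2) *\<^sub>R (x + y) - w) + (norm (x - w))\<^sup>2 + (norm (y - w))\<^sup>2 + s\<^sup>2 * X\<^sup>2)\<^sup>2
      \<le> M2 \<kappa> * s\<^sup>2 * (260 * V)"
    using M_nonneg V_bounds(5) by (intro mult_left_mono) auto
  then have 6: "?E (\<lambda>z. (norm ((1/2) *\<^sub>R (two_step (s\<^sup>2) x (fst z) (snd z) + two_step (s\<^sup>2) y (snd z) (fst z))
        - step (2 * s\<^sup>2) w (fst z + snd z)))\<^sup>2)
      \<le> (norm ((1/2) *\<^sub>R (x + y) - w))\<^sup>2 + M2 \<kappa> * s\<^sup>2 * (260 * V)"
    using antithetic_average_step[OF s p q X(1,2), of w] by linarith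
  have "?E (\<lambda>z. lyapunov s (two_step (s\<^sup>2) x (fst z) (snd z))
      (two_step (s\<^sup>2) y (snd z) (fst z)) (step (2 * s\<^sup>2) w (fst z + snd z)))
    = ?E (\<lambda>z. (norm ((1/2) *\<^sub>R (two_step (s\<^sup>2) x (fst z) (snd z) + two_step (s\<^sup>2) y (snd z) (fst z))
        - step (2 * s\<^sup>2) w (fst z + snd z)))\<^sup>2)
    + ?E (\<lambda>z. norm (two_step (s\<^sup>2) x (fst z) (snd z) - step (2 * s\<^sup>2) w (fst z + snd z)) ^ 4)
    + ?E (\<lambda>z. norm (two_step (s\<^sup>2) y (snd z) (fst z) - step (2 * s\<^sup>2) w (fst z + snd z)) ^ 4)
    + s ^ 4 * (1 + ?E (\<lambda>z. norm (two_step (s\<^sup>2) x (fst z) (snd z)) ^ 4)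
      + ?E (\<lambda>z. norm (two_step (s\<^sup>2) y (snd z) (fst z)) ^ 4)
      + ?E (\<lambda>z. norm (step (2 * s\<^sup>2) w (fst z + snd z)) ^ 4))"
    unfolding lyapunov_def by (simp add: int)
  also have "\<dots> \<le> ((norm ((1/2) *\<^sub>R (x + y) - w))\<^sup>2 + M2 \<kappa> * s\<^sup>2 * (260 * V))
    + (norm (x - w) ^ 4 + r * (520 * V)) + (norm (y - w) ^ 4 + r * (520 * V))
    + s ^ 4 * (1 + (norm x ^ 4 + r * (1 + norm x) ^ 4) + (norm y ^ 4 + r * (1 + norm y) ^ 4)
        + (norm w ^ 4 + r * (1 + norm w) ^ 4))"
    using 1 2 3 4 5 6 by (intro add_mono mult_left_mono) auto
  also have "\<dots> = (norm ((1/2) *\<^sub>R (x + y) - w))\<^sup>2 + norm (x - w) ^ 4 + norm (y - w) ^ 4 + s ^ 4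
      + s ^ 4 * (norm x ^ 4 + r * (1 + norm x) ^ 4) + s ^ 4 * (norm y ^ 4 + r * (1 + norm y) ^ 4)
      + s ^ 4 * (norm w ^ 4 + r * (1 + norm w) ^ 4) + M2 \<kappa> * s\<^sup>2 * (260 * V) + 1040 * (r * V)"
    by (simp add: algebra_simps)
  also have "\<dots> \<le> (norm ((1/2) *\<^sub>R (x + y) - w))\<^sup>2 + norm (x - w) ^ 4 + norm (y - w) ^ 4 + s ^ 4
      + (s ^ 4 * norm x ^ 4 + 64 * (r * V)) + (s ^ 4 * norm y ^ 4 + 64 * (r * V))
      + (s ^ 4 * norm w ^ 4 + 64 * (r * V)) + M2 \<kappa> * s\<^sup>2 * (260 * V) + 1040 * (r * V)"
    by (intro add_mono order_refl moment X)
  also have "\<dots> = (1 + growth \<kappa> * s\<^sup>2) * V"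
    by (simp add: V_def lyapunov_def growth_def r_def algebra_simps)
  finally show ?thesis by (simp add: V_def)
qed

end

subsection \<open>The coupled paths\<close>

lemma xi_finest_cong: "\<omega> i = \<omega>' i \<Longrightarrow> xi_finest T L \<omega> i = xi_finest T L \<omega>' i"
  by (simp add: xi_finest_def)

text \<open>Blocks are counted from 0 and signs from 1: block \<open>k\<close> carries the increment
  of step \<open>Suc k\<close>.\<close>

definition block :: "nat \<Rightarrow> nat \<Rightarrow> nat set" where
  "block B k = {k * B + 1..Suc k * B}"

definition block_sum :: "real \<Rightarrow> nat \<Rightarrow> nat set \<Rightarrow> (nat \<Rightarrow> 'm::finite \<Rightarrow> bool) \<Rightarrow> real^'m" where
  "block_sum T L I \<omega> = (\<Sum>r\<in>I. xi_finest T L \<omega> r)"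

lemma block_sum_cong: "(\<And>i. i \<in> I \<Longrightarrow> \<omega> i = \<omega>' i) \<Longrightarrow> block_sum T L I \<omega> = block_sum T L I \<omega>'"
  unfolding block_sum_def by (intro sum.cong refl xi_finest_cong)

lemma xi_fine_Suc: "xi_fine T L l \<omega> (Suc k) = block_sum T L (block (2 ^ (L - l)) k) \<omega>"
  by (simp add: xi_fine_def block_sum_def block_def)

lemma card_block [simp]: "card (block B k) = B"
  by (simp add: block_def)

lemma finite_block [simp]: "finite (block B k)"
  by (simp add: block_def)

lemma block_disjoint:
  "block B k \<inter> block B (Suc k) = {}" "{1..k * B} \<inter> (block B k \<union> block B (Suc k)) = {}"
  by (auto simp: block_def)

lemma block_union: "{1..k * B} \<union> (block B k \<union> block B (Suc k)) = {1..Suc (Suc k) * B}"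
proof (intro set_eqI iffI)
  fix i assume i: "i \<in> {1..Suc (Suc k) * B}"
  then show "i \<in> {1..k * B} \<union> (block B k \<union> block B (Suc k))"
    by (cases "i \<le> k * B"; cases "i \<le> Suc k * B") (auto simp: block_def)
qed (auto simp: block_def intro: order_trans[of _ "k * B"] order_trans[of _ "B + k * B"])

context milstein_coefficients
begin

context
  fixes T :: real and L l :: nat and X0 :: "real^'d"
begin

definition fine_path :: "(nat \<Rightarrow> 'm \<Rightarrow> bool) \<Rightarrow> nat \<Rightarrow> real^'d" where
  "fine_path \<omega> n = milstein \<mu> \<sigma> (step_size T l) X0 (xi_fine T L l \<omega>) (2 * n)"

definition antithetic_path :: "(nat \<Rightarrow> 'm \<Rightarrow> bool) \<Rightarrow> nat \<Rightarrow> real^'d" where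
  "antithetic_path \<omega> n = milstein \<mu> \<sigma> (step_size T l) X0 (xi_anti T L l \<omega>) (2 * n)"

text \<open>The step size is written as twice the fine one, which avoids subtraction on the level.
  The other two paths are sampled at every second step so that all three share the coarse time
  index.\<close>

definition coarse_path :: "(nat \<Rightarrow> 'm \<Rightarrow> bool) \<Rightarrow> nat \<Rightarrow> real^'d" where
  "coarse_path \<omega> n = milstein \<mu> \<sigma> (2 * step_size T l) X0 (xi_coarse T L l \<omega>) n"

definition inc :: "(nat \<Rightarrow> 'm \<Rightarrow> bool) \<Rightarrow> nat \<Rightarrow> real^'m" where
  "inc \<omega> k = block_sum T L (block (2 ^ (L - l)) k) \<omega>"

lemma paths_0: "fine_path \<omega> 0 = X0" "antithetic_path \<omega> 0 = X0" "coarse_path \<omega> 0 = X0"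
  by (simp_all add: fine_path_def antithetic_path_def coarse_path_def)

lemma fine_path_Suc:
  "fine_path \<omega> (Suc n) = two_step (step_size T l) (fine_path \<omega> n) (inc \<omega> (2 * n)) (inc \<omega> (Suc (2 * n)))"
  by (simp add: fine_path_def two_step_def milstein_step_eq xi_fine_Suc inc_def)

text \<open>Step \<open>Suc (2 * n)\<close> is odd and takes the following increment, the next step
  takes the preceding one; with blocks counted from 0 this exchanges \<open>2 * n\<close> and
  \<open>Suc (2 * n)\<close>.\<close>

lemma antithetic_path_Suc:
  "antithetic_path \<omega> (Suc n)
    = two_step (step_size T l) (antithetic_path \<omega> n) (inc \<omega> (Suc (2 * n))) (inc \<omega> (2 * n))"
  by (simp add: antithetic_path_def two_step_def milstein_step_eq xi_anti_def xi_fine_Suc inc_def)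

lemma coarse_path_Suc:
  "coarse_path \<omega> (Suc n) = step (2 * step_size T l) (coarse_path \<omega> n) (inc \<omega> (2 * n) + inc \<omega> (Suc (2 * n)))"
proof -
  have "xi_coarse T L l \<omega> (Suc n) = inc \<omega> (2 * n) + inc \<omega> (Suc (2 * n))"
    by (simp add: xi_coarse_def xi_fine_Suc inc_def)
  then show ?thesis by (simp add: coarse_path_def milstein_step_eq)
qed

lemma inc_cong:
  assumes "\<And>i. i \<in> block (2 ^ (L - l)) k \<Longrightarrow> \<omega> i = \<omega>' i"
  shows "inc \<omega> k = inc \<omega>' k"
  using assms unfolding inc_def by (rule block_sum_cong)

text \<open>Adaptedness: up to coarse time \<open>n\<close> the paths depend only on the signs
  already used, hence do not change when fresh signs are integrated.\<close>

lemma paths_cong: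
  assumes "\<And>i. i \<in> {1..2 * n * 2 ^ (L - l)} \<Longrightarrow> \<omega> i = \<omega>' i"
  shows "fine_path \<omega> n = fine_path \<omega>' n \<and> antithetic_path \<omega> n = antithetic_path \<omega>' n
    \<and> coarse_path \<omega> n = coarse_path \<omega>' n"
  using assms
proof (induction n)
  case 0
  show ?case by (simp add: paths_0)
next
  case (Suc n)
  have union: "{1..2 * n * 2 ^ (L - l)} \<union> (block (2 ^ (L - l)) (2 * n) \<union> block (2 ^ (L - l)) (Suc (2 * n)))
      = {1..2 * Suc n * 2 ^ (L - l)}"
    using block_union[of "2 * n" "2 ^ (L - l)"] by simp
  have "inc \<omega> (2 * n) = inc \<omega>' (2 * n)" "inc \<omega> (Suc (2 * n)) = inc \<omega>' (Suc (2 * n))"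
    using Suc.prems unfolding union[symmetric] by (auto intro: inc_cong)
  moreover have "fine_path \<omega> n = fine_path \<omega>' n \<and> antithetic_path \<omega> n = antithetic_path \<omega>' n
    \<and> coarse_path \<omega> n = coarse_path \<omega>' n"
    using Suc.prems unfolding union[symmetric] by (intro Suc.IH) auto
  ultimately show ?case
    by (simp add: fine_path_Suc antithetic_path_Suc coarse_path_Suc)
qed

text \<open>The signs split into the past \<open>A\<close> and two fresh blocks \<open>I\<close> and
  \<open>J\<close>. With the past frozen, the three states are constants and the two block sums are
  independent increments, so the one-step estimate applies inside the outer expectation.\<close>

lemma lyapunov_path_step:
  assumes T: "T > 0" and l: "l \<le> L" and s: "s\<^sup>2 = step_size T l" "0 < s" "s \<le> \<tau>"
  defines "V \<equiv> \<lambda>n \<omega>. lyapunov s (fine_path \<omega> n) (antithetic_path \<omega> n) (coarse_path \<omega> n)"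
    and "\<kappa> \<equiv> weight_bound TYPE('m)"
  shows "measure_pmf.expectation (sign_paths {1..2 * Suc n * 2 ^ (L - l)}) (V (Suc n))
    \<le> (1 + growth \<kappa> * s\<^sup>2) * measure_pmf.expectation (sign_paths {1..2 * n * 2 ^ (L - l)}) (V n)"
proof -
  define A I J where "A = {1..2 * n * 2 ^ (L - l)}" and "I = block (2 ^ (L - l)) (2 * n)"
    and "J = block (2 ^ (L - l)) (Suc (2 * n))"
  define p where "p = map_pmf (block_sum T L I) (sign_paths I :: (nat \<Rightarrow> 'm \<Rightarrow> bool) pmf)"
  define q where "q = map_pmf (block_sum T L J) (sign_paths J :: (nat \<Rightarrow> 'm \<Rightarrow> bool) pmf)"
  have fin: "finite A" "finite I" "finite J"
    by (simp_all add: A_def I_def J_def)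
  have disj: "A \<inter> (I \<union> J) = {}" "I \<inter> J = {}"
    unfolding A_def I_def J_def
    using block_disjoint[where k = "2 * n" and B = "2 ^ (L - l)"] by simp_all
  have union: "{1..2 * Suc n * 2 ^ (L - l)} = A \<union> (I \<union> J)"
    unfolding A_def I_def J_def using block_union[of "2 * n" "2 ^ (L - l)"] by simp
  have p: "increment_law \<kappa> (s\<^sup>2) p"
    using increment_law_sum_xi_finest[OF T fin(2) _ l, where 'm = 'm]
    by (simp add: p_def \<kappa>_def s I_def block_sum_def[abs_def])
  have q: "increment_law \<kappa> (s\<^sup>2) q"
    using increment_law_sum_xi_finest[OF T fin(3) _ l, where 'm = 'm]
    by (simp add: q_def \<kappa>_def s J_def block_sum_def[abs_def])
  have step: "measure_pmf.expectation (sign_paths (I \<union> J))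
      (\<lambda>\<omega>'. V (Suc n) (\<lambda>i. if i \<in> A then \<omega> i else \<omega>' i)) \<le> (1 + growth \<kappa> * s\<^sup>2) * V n \<omega>" for \<omega>
  proof -
    define F where "F z = lyapunov s (two_step (s\<^sup>2) (fine_path \<omega> n) (fst z) (snd z))
      (two_step (s\<^sup>2) (antithetic_path \<omega> n) (snd z) (fst z))
      (step (2 * s\<^sup>2) (coarse_path \<omega> n) (fst z + snd z))" for z
    have V_Suc: "V (Suc n) (\<lambda>i. if i \<in> A then \<omega> i else if i \<in> I then \<omega>1 i else \<omega>2 i)
        = F (block_sum T L I \<omega>1, block_sum T L J \<omega>2)" for \<omega>1 \<omega>2
    proof -
      let ?w = "\<lambda>i. if i \<in> A then \<omega> i else if i \<in> I then \<omega>1 i else \<omega>2 i"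
      have "inc ?w (2 * n) = block_sum T L I \<omega>1"
        unfolding inc_def I_def[symmetric] using disj by (intro block_sum_cong) auto
      moreover have "inc ?w (Suc (2 * n)) = block_sum T L J \<omega>2"
        unfolding inc_def J_def[symmetric] using disj by (intro block_sum_cong) auto
      moreover have "fine_path ?w n = fine_path \<omega> n \<and> antithetic_path ?w n = antithetic_path \<omega> n
          \<and> coarse_path ?w n = coarse_path \<omega> n"
        by (rule paths_cong) (simp add: A_def)
      ultimately show ?thesis
        by (simp add: V_def F_def fine_path_Suc antithetic_path_Suc coarse_path_Suc s)
    qed
    have "measure_pmf.expectation (sign_paths (I \<union> J)) (\<lambda>\<omega>'. V (Suc n) (\<lambda>i. if i \<in> A then \<omega> i else \<omega>' i))
        = measure_pmf.expectation (pair_pmf p q) F"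
      using fin disj
      by (simp add: expectation_sign_paths_union V_Suc integral_pair_pmf_finite p_def q_def)
    also have "\<dots> \<le> (1 + growth \<kappa> * s\<^sup>2) * V n \<omega>"
      unfolding F_def V_def by (rule lyapunov_step[OF s(2,3) p q])
    finally show ?thesis .
  qed
  have "measure_pmf.expectation (sign_paths (A \<union> (I \<union> J))) (V (Suc n))
      = measure_pmf.expectation (sign_paths A) (\<lambda>\<omega>. measure_pmf.expectation (sign_paths (I \<union> J))
          (\<lambda>\<omega>'. V (Suc n) (\<lambda>i. if i \<in> A then \<omega> i else \<omega>' i)))"
    using fin disj by (intro expectation_sign_paths_union) auto
  also have "\<dots> \<le> measure_pmf.expectation (sign_paths A) (\<lambda>\<omega>. (1 + growth \<kappa> * s\<^sup>2) * V n \<omega>)"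
    using fin step by (intro expectation_mono_finite) auto
  finally show ?thesis
    unfolding union A_def[symmetric] by simp
qed

lemma lyapunov_path_bound:
  assumes T: "T > 0" and l: "l \<le> L" and s: "s\<^sup>2 = step_size T l" "0 < s" "s \<le> \<tau>"
  defines "\<kappa> \<equiv> weight_bound TYPE('m)"
  shows "measure_pmf.expectation (sign_paths {1..2 * n * 2 ^ (L - l)})
      (\<lambda>\<omega>. lyapunov s (fine_path \<omega> n) (antithetic_path \<omega> n) (coarse_path \<omega> n))
    \<le> (1 + growth \<kappa> * s\<^sup>2) ^ n * lyapunov s X0 X0 X0"
proof (induction n)
  case 0
  show ?case by (simp add: paths_0)
next
  case (Suc n)
  have "0 \<le> 1 + growth \<kappa> * s\<^sup>2"
    using M_nonneg(3)[of \<kappa>] by simp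
  from mult_left_mono[OF Suc this] show ?case
    using lyapunov_path_step[OF T l s, of n] unfolding \<kappa>_def by simp
qed

lemma lyapunov_diagonal: "lyapunov s X0 X0 X0 = s ^ 4 * (1 + 3 * norm X0 ^ 4)"
  by (simp add: lyapunov_def algebra_simps flip: scaleR_2)

section \<open>From the paths to the payoffs\<close>

lemma payoff_difference_bound:
  assumes f: "smooth_bounded K f Df" and l: "1 \<le> l"
  shows "(P_fine f \<mu> \<sigma> X0 T L l \<omega> - P_coarse f \<mu> \<sigma> X0 T L l \<omega>)\<^sup>2
    \<le> 12 * K\<^sup>2 * lyapunov s (fine_path \<omega> (2 ^ (l - 1))) (antithetic_path \<omega> (2 ^ (l - 1)))
        (coarse_path \<omega> (2 ^ (l - 1)))"
proof -
  define N :: nat where "N = 2 ^ (l - 1)"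
  define x y w where "x = fine_path \<omega> N" and "y = antithetic_path \<omega> N" and "w = coarse_path \<omega> N"
  define e where "e = (1/2) *\<^sub>R (x + y) - w"
  have pow: "(2::nat) ^ l = 2 * 2 ^ (l - 1)" "(2::real) ^ l = 2 * 2 ^ (l - 1)"
    using l by (cases l; simp)+
  have size: "step_size T (l - 1) = 2 * step_size T l"
    using pow(2) by (simp add: step_size_def)
  have "P_fine f \<mu> \<sigma> X0 T L l \<omega> - P_coarse f \<mu> \<sigma> X0 T L l \<omega> = (1/2) *\<^sub>R (f x + f y) - f w"
    by (simp add: P_fine_def P_coarse_def x_def y_def w_def fine_path_def antithetic_path_def
        coarse_path_def N_def size[simplified] pow(1))
  then have "\<bar>P_fine f \<mu> \<sigma> X0 T L l \<omega> - P_coarse f \<mu> \<sigma> X0 T L l \<omega>\<bar>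
      \<le> K * (norm e + 2 * ((norm (x - w))\<^sup>2 + (norm (y - w))\<^sup>2))"
    using smooth_average_bound[OF f, of x y w] by (simp add: e_def)
  then have "(P_fine f \<mu> \<sigma> X0 T L l \<omega> - P_coarse f \<mu> \<sigma> X0 T L l \<omega>)\<^sup>2
      \<le> (K * (norm e + 2 * ((norm (x - w))\<^sup>2 + (norm (y - w))\<^sup>2)))\<^sup>2"
    using power_mono[OF _ abs_ge_zero, of _ _ 2] by fastforce
  also have "\<dots> \<le> K\<^sup>2 * (12 * ((norm e)\<^sup>2 + norm (x - w) ^ 4 + norm (y - w) ^ 4))"
  proof -
    \<comment> \<open>Squaring a sum of three terms costs 3, and the coefficient 2 contributes 4,
      whence 12.\<close>
    have "(a + 2 * (c + d))\<^sup>2 \<le> 12 * (a\<^sup>2 + c\<^sup>2 + d\<^sup>2)" for a c d :: real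
    proof -
      have "12 * (a\<^sup>2 + c\<^sup>2 + d\<^sup>2) - (a + 2 * (c + d))\<^sup>2
          = (a - 2 * c)\<^sup>2 + (a - 2 * d)\<^sup>2 + 4 * (c - d)\<^sup>2 + 9 * a\<^sup>2"
        by (simp add: power2_eq_square algebra_simps)
      also have "\<dots> \<ge> 0" by simp
      finally show ?thesis by simp
    qed
    from this[of "norm e" "(norm (x - w))\<^sup>2" "(norm (y - w))\<^sup>2"] show ?thesis
      by (simp add: power_mult_distrib mult_left_mono flip: power_mult)
  qed
  also have "\<dots> \<le> K\<^sup>2 * (12 * lyapunov s x y w)"
    by (intro mult_left_mono) (auto simp: lyapunov_def e_def)
  finally show ?thesis by (simp add: x_def y_def w_def N_def)
qed

lemma expectation_payoff_difference:
  assumes T: "T > 0" and l: "1 \<le> l" "l \<le> L" and \<tau>T: "sqrt T \<le> \<tau>" and f: "smooth_bounded K f Df"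
  shows "measure_pmf.expectation (sample_pmf L)
      (\<lambda>\<omega>. (P_fine f \<mu> \<sigma> X0 T L l \<omega> - P_coarse f \<mu> \<sigma> X0 T L l \<omega>)\<^sup>2)
    \<le> 12 * K\<^sup>2 * exp (growth (weight_bound TYPE('m)) * T) * (1 + 3 * norm X0 ^ 4) * (step_size T l)\<^sup>2"
proof -
  define s where "s = sqrt (step_size T l)"
  define g where "g = growth (weight_bound TYPE('m))"
  define N :: nat where "N = 2 ^ (l - 1)"
  have h: "0 < step_size T l" "step_size T l \<le> T"
    using T by (auto simp: step_size_def divide_le_eq)
  have s: "s\<^sup>2 = step_size T l" "0 < s" "s \<le> \<tau>"
    using h \<tau>T by (auto simp: s_def intro: order_trans[rotated])
  have g: "0 \<le> g" by (simp add: g_def M_nonneg)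
  \<comment> \<open>After the \<open>N\<close> coarse steps, two blocks each, exactly all finest
    signs are used up.\<close>
  have pow: "2 * N * 2 ^ (L - l) = 2 ^ L"
  proof -
    have "2 * N * 2 ^ (L - l) = 2 ^ (Suc (l - 1) + (L - l))"
      by (simp add: N_def power_add)
    then show ?thesis using l by simp
  qed
  let ?V = "\<lambda>\<omega>. lyapunov s (fine_path \<omega> N) (antithetic_path \<omega> N) (coarse_path \<omega> N)"
  have "measure_pmf.expectation (sample_pmf L)
      (\<lambda>\<omega>. (P_fine f \<mu> \<sigma> X0 T L l \<omega> - P_coarse f \<mu> \<sigma> X0 T L l \<omega>)\<^sup>2)
    \<le> measure_pmf.expectation (sign_paths {1..2 * N * 2 ^ (L - l)}) (\<lambda>\<omega>. 12 * K\<^sup>2 * ?V \<omega>)"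
    unfolding sample_pmf_eq_sign_paths pow
    by (intro expectation_mono_finite payoff_difference_bound[OF f l(1), folded N_def]) simp
  also have "\<dots> \<le> 12 * K\<^sup>2 * ((1 + g * s\<^sup>2) ^ N * (s ^ 4 * (1 + 3 * norm X0 ^ 4)))"
    using lyapunov_path_bound[OF T l(2) s, of N] unfolding lyapunov_diagonal g_def
    by (simp add: mult_left_mono)
  also have "\<dots> \<le> 12 * K\<^sup>2 * (exp (g * T) * (s ^ 4 * (1 + 3 * norm X0 ^ 4)))"
  proof (intro mult_left_mono mult_right_mono)
    \<comment> \<open>The number of coarse steps times the fine step size is \<open>T / 2\<close>,
      so the accumulated growth is bounded independently of the level.\<close>
    have "(1 + g * s\<^sup>2) ^ N \<le> exp (g * s\<^sup>2) ^ N"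
      using g by (intro power_mono exp_ge_add_one_self) auto
    also have "\<dots> = exp (g * (real N * s\<^sup>2))"
      by (simp add: ac_simps flip: exp_of_nat_mult)
    also have "real N * s\<^sup>2 \<le> T"
      using T l(1) by (cases l) (auto simp: s(1) N_def step_size_def field_simps)
    finally show "(1 + g * s\<^sup>2) ^ N \<le> exp (g * T)"
      using g by (simp add: mult_left_mono)
  qed auto
  also have "s ^ 4 = (step_size T l)\<^sup>2"
    unfolding s(1)[symmetric] by (simp flip: power_mult)
  finally show ?thesis by (simp add: g_def ac_simps)
qed

end

end

theorem theorem1:
  fixes \<mu> :: "real^'d \<Rightarrow> real^'d"
    and \<sigma> :: "'m::finite \<Rightarrow> real^'d \<Rightarrow> real^'d"
    and f :: "real^'d \<Rightarrow> real"
    and X0 :: "real^'d"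
    and T :: real
  assumes "T > 0"
    and "C2_bounded \<mu>"
    and "\<And>j. C2_bounded (\<sigma> j)"
    and "C2_bounded f"
  shows "\<exists>C. \<forall>L l. 1 \<le> L \<and> 1 \<le> l \<and> l \<le> L \<longrightarrow>
     measure_pmf.variance (sample_pmf L :: (nat \<Rightarrow> 'm \<Rightarrow> bool) pmf)
        (\<lambda>\<omega>. P_fine f \<mu> \<sigma> X0 T L l \<omega> - P_coarse f \<mu> \<sigma> X0 T L l \<omega>)
     \<le> measure_pmf.expectation (sample_pmf L :: (nat \<Rightarrow> 'm \<Rightarrow> bool) pmf)
        (\<lambda>\<omega>. (P_fine f \<mu> \<sigma> X0 T L l \<omega> - P_coarse f \<mu> \<sigma> X0 T L l \<omega>)\<^sup>2)
   \<and> measure_pmf.expectation (sample_pmf L :: (nat \<Rightarrow> 'm \<Rightarrow> bool) pmf)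
        (\<lambda>\<omega>. (P_fine f \<mu> \<sigma> X0 T L l \<omega> - P_coarse f \<mu> \<sigma> X0 T L l \<omega>)\<^sup>2)
     \<le> C * (step_size T l)\<^sup>2"
proof -
  obtain K\<mu> D\<mu> where \<mu>: "\<And>K. K \<ge> K\<mu> \<Longrightarrow> smooth_bounded K \<mu> D\<mu>"
    using C2_bounded_imp_smooth_bounded[OF assms(2)] by blast
  obtain Kf Df where f: "\<And>K. K \<ge> Kf \<Longrightarrow> smooth_bounded K f Df"
    using C2_bounded_imp_smooth_bounded[OF assms(4)] by blast
  obtain K\<sigma> D\<sigma> where \<sigma>: "\<And>j K. K \<ge> K\<sigma> j \<Longrightarrow> smooth_bounded K (\<sigma> j) (D\<sigma> j)"
    using C2_bounded_imp_smooth_bounded[OF assms(3)] by metis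
  \<comment> \<open>Finitely many noise components make this maximum available; the 1 meets the
    normalisation of the locale.\<close>
  define K where "K = Max ({1, K\<mu>, Kf} \<union> range K\<sigma>)"
  define \<tau> where "\<tau> = max 1 (sqrt T)"
  have K_ge: "1 \<le> K" "K\<mu> \<le> K" "Kf \<le> K" "K\<sigma> j \<le> K" for j
    unfolding K_def by (intro Max_ge; simp)+
  interpret milstein_coefficients \<mu> \<sigma> D\<mu> D\<sigma> K \<tau>
    using K_ge by unfold_locales (auto simp: \<tau>_def intro: \<mu> \<sigma>)
  have variance_le: "measure_pmf.variance (sample_pmf L :: (nat \<Rightarrow> 'm \<Rightarrow> bool) pmf) Z
      \<le> measure_pmf.expectation (sample_pmf L) (\<lambda>\<omega>. (Z \<omega>)\<^sup>2)" for Z :: "_ \<Rightarrow> real" and L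
  proof -
    have "integrable (sample_pmf L :: (nat \<Rightarrow> 'm \<Rightarrow> bool) pmf) (g :: _ \<Rightarrow> real)" for g
      unfolding sample_pmf_eq_sign_paths by (intro integrable_measure_pmf_finite) simp
    then show ?thesis
      using measure_pmf.variance_eq[of "sample_pmf L" Z] by simp
  qed
  show ?thesis
    \<comment> \<open>The witness stays schematic and is read off from the final bound. As it is
      fixed before \<open>L\<close> and \<open>l\<close> are introduced, it can contain
      neither.\<close>
    by (intro exI allI impI conjI variance_le,
        rule expectation_payoff_difference[OF assms(1) _ _ _ f[OF K_ge(3)]])
       (auto simp: \<tau>_def)
qed

end
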